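(* A $d$-dimensional simplicial complex $X$ is $\mathbb{F}$-tight if and only if $X$ is connected and $\mu_j(X)=\beta_j(X)$ for all $0\leq j\leq d$.
   Context: All simplicial complexes are finite and abstract, and the empty set is a face (of dimension $-1$) of every simplicial complex. A field $\mathbb{F}$ is fixed; $H_*$ is (unreduced) simplicial homology with coefficients in $\mathbb{F}$ and $\beta_i(X)=\dim_{\mathbb F}H_i(X)$. $V(X)$ is the vertex set of $X$; for any set $A$, $X[A]=\{\alpha\in X:\alpha\subseteq A\}$; the induced subcomplexes of $X$ are the $X[A]$. $f_0(X)$ is the number of vertices of $X$. For $x\in V(X)$, $\mathrm{lk}(x,X)=\{\alpha: x\notin\alpha,\ \alpha\sqcup\{x\}\in X\}$. Tightness. $X$ is $\mathbb{F}$-tight if $X$ is connected and, for every induced subcomplex $Y$ of $X$, the morphism $H_*(Y)\to H_*(X)$ induced by the inclusion map $Y\to X$ is injective. Sigma- and mu-vectors. Reduced Betti numbers: $\tilde\beta_0(X)=\beta_0(X)-1$ (so $\tilde\beta_0(\{\emptyset\})=-1$) and $\tilde\beta_i(X)=\beta_i(X)$ for $i\ge1$. Put $\sigma_i(X)=\sum_{A\subseteq V(X)}\tilde\beta_i(X[A])\big/\binom{f_0(X)}{\#(A)}$ for $i\ge 0$ (the sum includes $A=\emptyset$; thus $\sigma_i(X)=0$ for $i>\dim X$, except that $\sigma_0(\{\emptyset\})=-1$). The mu-vector $(\mu_0,\dots,\mu_d)$ of a $d$-dimensional simplicial complex $X$ is $$\mu_0(X)=\sum_{x\in V(X)}\frac{1}{1+f_0(\mathrm{lk}(x,X))},\qquad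 \mu_i(X)=\sum_{x\in V(X)}\frac{\delta_{i1}+\sigma_{i-1}(\mathrm{lk}(x,X))}{1+f_0(\mathrm{lk}(x,X))}\quad(1\le i\le d),$$ where $\delta_{ij}$ is the Kronecker symbol. *)

theory Defs
  imports "HOL-Algebra.AbelCoset" "Jordan_Normal_Form.VS_Connect" "HOL-Combinatorics.Permutations"
begin

section \<open>Simplicial complexes\<close>

definition simplicial_complex :: "'v set set \<Rightarrow> bool" where
  "simplicial_complex X \<longleftrightarrow> finite X \<and> (\<forall>\<alpha>\<in>X. finite \<alpha>) \<and> {} \<in> X \<and>
     (\<forall>\<alpha>\<in>X. \<forall>\<beta>. \<beta> \<subseteq> \<alpha> \<longrightarrow> \<beta> \<in> X)"

text \<open>An integer, since the empty face has dimension \<open>-1\<close>.\<close>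

definition complex_dim :: "'v set set \<Rightarrow> int" where
  "complex_dim X = Max ((\<lambda>\<alpha>. int (card \<alpha>) - 1) ` X)"

definition vertices :: "'v set set \<Rightarrow> 'v set" where
  "vertices X = {x. {x} \<in> X}"

definition f0 :: "'v set set \<Rightarrow> nat" where
  "f0 X = card (vertices X)"

definition induced :: "'v set set \<Rightarrow> 'v set \<Rightarrow> 'v set set" where
  "induced X A = {\<alpha> \<in> X. \<alpha> \<subseteq> A}"

definition link :: "'v \<Rightarrow> 'v set set \<Rightarrow> 'v set set" where
  "link x X = {\<alpha>. x \<notin> \<alpha> \<and> insert x \<alpha> \<in> X}"

text \<open>Any two vertices are joined by an edge path. In particular the complex whose only face
  is the empty set counts as connected.\<close>

definition connected_complex :: "'v set set \<Rightarrow> bool" where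
  "connected_complex X \<longleftrightarrow>
     (\<forall>x\<in>vertices X. \<forall>y\<in>vertices X. (x, y) \<in> {(u, v). {u, v} \<in> X}\<^sup>*)"


section \<open>Simplicial homology\<close>

text \<open>
  An oriented \<open>i\<close>-chain is given by its coefficients: \<open>c [v\<^sub>0, \<dots>, v\<^sub>i]\<close> is the coefficient of
  the oriented simplex \<open>[v\<^sub>0, \<dots>, v\<^sub>i]\<close>, so a permutation of the vertices multiplies it by the sign
  of the permutation. This avoids the choice of a vertex ordering, and the chain map induced by
  the inclusion of a subcomplex is the identity on coefficient functions.
\<close>

definition oriented_chains :: "'v set set \<Rightarrow> nat \<Rightarrow> ('v list \<Rightarrow> 'f::field) set" where
  "oriented_chains X i = {c.
     (\<forall>vs. c vs \<noteq> 0 \<longrightarrow> length vs = Suc i \<and> distinct vs \<and> set vs \<in> X) \<and>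
     (\<forall>vs \<pi>. \<pi> permutes {..<length vs} \<longrightarrow>
        c (permute_list \<pi> vs) = of_int (sign \<pi>) * c vs)}"

text \<open>
  The boundary operator \<open>[v\<^sub>0, \<dots>, v\<^sub>i] \<mapsto> \<Sum>j. (-1)\<^sup>j [v\<^sub>0, \<dots>, v\<^sub>j\<^sub>-\<^sub>1, v\<^sub>j\<^sub>+\<^sub>1, \<dots>, v\<^sub>i]\<close> on coefficients:
  moving \<open>v\<^sub>j\<close> to the front has sign \<open>(-1)\<^sup>j\<close>. Homology is unreduced, hence
  the boundary vanishes on the empty list, i.e. on the face of dimension \<open>-1\<close>.
\<close>

definition boundary_op :: "'v set set \<Rightarrow> ('v list \<Rightarrow> 'f::field) \<Rightarrow> 'v list \<Rightarrow> 'f" where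
  "boundary_op X c = (\<lambda>vs. if vs = [] then 0 else (\<Sum>v\<in>vertices X. c (v # vs)))"

definition cycles :: "'v set set \<Rightarrow> nat \<Rightarrow> ('v list \<Rightarrow> 'f::field) set" where
  "cycles X i = {c \<in> oriented_chains X i. boundary_op X c = (\<lambda>_. 0)}"

definition boundaries :: "'v set set \<Rightarrow> nat \<Rightarrow> ('v list \<Rightarrow> 'f::field) set" where
  "boundaries X i = boundary_op X ` oriented_chains X (Suc i)"

text \<open>The fields \<open>mult\<close> and \<open>one\<close> of the record type \<open>module\<close> are irrelevant here.\<close>

definition fun_space :: "('f::field, 'b \<Rightarrow> 'f) module" where
  "fun_space = \<lparr>carrier = UNIV, mult = (\<lambda>_ _ _. 0), one = (\<lambda>_. 0), zero = (\<lambda>_. 0),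
     add = (\<lambda>f g x. f x + g x), smult = (\<lambda>a f x. a * f x)\<rparr>"

definition quotient_space :: "('a, 'c) module \<Rightarrow> 'c set \<Rightarrow> ('a, 'c set) module" where
  "quotient_space V W = \<lparr>carrier = a_rcosets\<^bsub>V\<^esub> W, mult = (\<lambda>_ _. W), one = W, zero = W,
     add = set_add V, smult = (\<lambda>a C. \<Union>v\<in>C. W +>\<^bsub>V\<^esub> (a \<odot>\<^bsub>V\<^esub> v))\<rparr>"

definition homology :: "'v set set \<Rightarrow> nat \<Rightarrow> ('f::field, ('v list \<Rightarrow> 'f) set) module" where
  "homology X i = quotient_space (fun_space\<lparr>carrier := cycles X i\<rparr>) (boundaries X i)"

definition betti :: "'f::field itself \<Rightarrow> 'v set set \<Rightarrow> nat \<Rightarrow> nat" where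
  "betti F X i =
     vectorspace.dim class_ring (homology X i :: ('f, ('v list \<Rightarrow> 'f) set) module)"

text \<open>The map \<open>H\<^sub>i(Y) \<rightarrow> H\<^sub>i(X)\<close> induced by the inclusion of a subcomplex \<open>Y\<close> of \<open>X\<close>: the class in
  \<open>Y\<close> of a cycle \<open>z\<close> goes to the class of \<open>z\<close> in \<open>X\<close>.\<close>

definition inclusion_map ::
  "'v set set \<Rightarrow> nat \<Rightarrow> ('v list \<Rightarrow> 'f::field) set \<Rightarrow> ('v list \<Rightarrow> 'f) set" where
  "inclusion_map X i C = (\<Union>z\<in>C. boundaries X i +>\<^bsub>fun_space\<^esub> z)"


section \<open>Tightness\<close>

definition tight :: "'f::field itself \<Rightarrow> 'v set set \<Rightarrow> bool" where
  "tight F X \<longleftrightarrow> connected_complex X \<and>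
     (\<forall>A i. inj_on (inclusion_map X i)
        (carrier (homology (induced X A) i :: ('f, ('v list \<Rightarrow> 'f) set) module)))"


section \<open>Sigma- and mu-vectors\<close>

definition reduced_betti :: "'f::field itself \<Rightarrow> 'v set set \<Rightarrow> nat \<Rightarrow> int" where
  "reduced_betti F X i = (if i = 0 then int (betti F X 0) - 1 else int (betti F X i))"

definition sigma :: "'f::field itself \<Rightarrow> 'v set set \<Rightarrow> nat \<Rightarrow> real" where
  "sigma F X i = (\<Sum>A\<in>Pow (vertices X).
     real_of_int (reduced_betti F (induced X A) i) / real (f0 X choose card A))"

definition mu :: "'f::field itself \<Rightarrow> 'v set set \<Rightarrow> nat \<Rightarrow> real" where
  "mu F X i =
     (if i = 0 then \<Sum>x\<in>vertices X. 1 / (1 + real (f0 (link x X)))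
      else \<Sum>x\<in>vertices X.
        ((if i = 1 then 1 else 0) + sigma F (link x X) (i - 1)) / (1 + real (f0 (link x X))))"

end

theory Submission
  imports Defs
begin

text \<open>
  Build \<open>X\<close> by adding its vertices one at a time, in some order. Adding \<open>v\<close> to the induced subcomplex
  \<open>X[A]\<close> attaches a cone over the part of the link of \<open>v\<close> spanned by \<open>A\<close>, so the relative homology of
  \<open>X[A \<union> {v}]\<close> modulo \<open>X[A]\<close> in degree \<open>j\<close> is the reduced homology of this part in degree \<open>j - 1\<close>. Let
  \<open>k\<^sub>j(A, v)\<close> be the dimension of the kernel of \<open>H\<^sub>j(X[A]) \<rightarrow> H\<^sub>j(X[A \<union> {v}])\<close>. The homology sequence of
  the pair shows that the dimension of the relative homology is the increment of \<open>\<beta>\<^sub>j\<close> plus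
  \<open>k\<^sub>j(A, v) + k\<^sub>j\<^sub>-\<^sub>1(A, v)\<close> (lemma \<open>betti_step\<close>), where \<open>k\<^sub>-\<^sub>1 = 0\<close>.

  Now average over all orders of the vertices. The neighbours of \<open>v\<close> that precede \<open>v\<close> in a random order
  have a uniformly distributed number between \<open>0\<close> and \<open>f\<^sub>0(lk(v, X))\<close>, and given their number they form
  a random set. So the sums of relative dimensions average to \<open>\<mu>\<^sub>j(X)\<close>
  (\<open>mu_eq_weighted_relative_betti\<close>), while the increments of \<open>\<beta>\<^sub>j\<close> telescope to \<open>\<beta>\<^sub>j(X)\<close>
  (\<open>sum_prefix_weight_telescope\<close>). Hence \<open>\<mu>\<^sub>j(X) - \<beta>\<^sub>j(X)\<close> is a sum of the numbers
  \<open>k\<^sub>j(A, v) + k\<^sub>j\<^sub>-\<^sub>1(A, v)\<close> with positive weights (\<open>mu_eq_betti_plus_killed\<close>), and equality in all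
  degrees means that adding a vertex never kills a homology class. As every inclusion \<open>X[A] \<rightarrow> X\<close> is a
  composition of such steps, this is tightness for connected \<open>X\<close>
  (\<open>tight_iff_nothing_killed\<close>).

  Instead of random orders, the proof uses the weight of a pair \<open>(A, v)\<close>, the probability that \<open>A\<close> is
  the set of predecessors of \<open>v\<close>. Instead of exact sequences, it counts dimensions of spaces of chains:
  contraction by \<open>v\<close>, \<open>c \<mapsto> c (v # _)\<close>, maps the chains of \<open>X[A \<union> {v}]\<close> onto the augmented chains of
  the link, with the chains of \<open>X[A]\<close> as kernel, and it commutes with the boundary up to sign. Rank-nullity
  on chains and on boundaries gives all the dimensions.
\<close>

section \<open>Finite-dimensional spaces of functions\<close>

abbreviation fun_subspace :: "('b \<Rightarrow> 'f::field) set \<Rightarrow> bool" where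
  "fun_subspace W \<equiv> subspace class_ring W (fun_space :: ('f, 'b \<Rightarrow> 'f) module)"

abbreviation subdim :: "('b \<Rightarrow> 'f::field) set \<Rightarrow> nat" where
  "subdim W \<equiv> vectorspace.dim class_ring ((fun_space :: ('f, 'b \<Rightarrow> 'f) module)\<lparr>carrier := W\<rparr>)"

lemma fun_space_simps [simp]:
  "carrier fun_space = UNIV"
  "f \<oplus>\<^bsub>fun_space\<^esub> g = (\<lambda>x. f x + g x)"
  "a \<odot>\<^bsub>fun_space\<^esub> f = (\<lambda>x. a * f x)"
  "\<zero>\<^bsub>fun_space\<^esub> = (\<lambda>x. 0)"
  by (simp_all add: fun_space_def)

lemma vectorspace_fun_space: "vectorspace class_ring (fun_space :: ('f::field, 'b \<Rightarrow> 'f) module)"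
proof -
  have "module class_ring (fun_space :: ('f, 'b \<Rightarrow> 'f) module)"
  proof (rule module_criteria)
    show "\<forall>v\<in>carrier (fun_space :: ('f, 'b \<Rightarrow> 'f) module). \<exists>w\<in>carrier fun_space.
        v \<oplus>\<^bsub>fun_space\<^esub> w = \<zero>\<^bsub>fun_space\<^esub>"
    proof
      fix v :: "'b \<Rightarrow> 'f"
      show "\<exists>w\<in>carrier fun_space. v \<oplus>\<^bsub>fun_space\<^esub> w = \<zero>\<^bsub>fun_space\<^esub>"
        by (rule bexI[of _ "\<lambda>x. - v x"]) auto
    qed
  qed (auto simp: class_cring.is_cring algebra_simps fun_space_def class_ring_simps)
  then show ?thesis
    unfolding vectorspace_def using class_field.field_axioms by blast
qed

interpretation FS: vectorspace class_ring fun_space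
  by (rule vectorspace_fun_space)

lemma fun_subspace_iff:
  "fun_subspace W \<longleftrightarrow> (\<lambda>_. 0) \<in> W \<and> (\<forall>f\<in>W. \<forall>g\<in>W. (\<lambda>x. f x + g x) \<in> W) \<and>
     (\<forall>a. \<forall>f\<in>W. (\<lambda>x. a * f x) \<in> W)"
  unfolding subspace_def submodule_def
  using vectorspace_fun_space FS.module_axioms by (auto simp: module_def)

lemma fun_subspace_zero: "fun_subspace W \<Longrightarrow> (\<lambda>_. 0) \<in> W"
  by (simp add: fun_subspace_iff)

lemma fun_subspace_add: "fun_subspace W \<Longrightarrow> f \<in> W \<Longrightarrow> g \<in> W \<Longrightarrow> (\<lambda>x. f x + g x) \<in> W"
  by (simp add: fun_subspace_iff)

lemma fun_subspace_smult: "fun_subspace W \<Longrightarrow> f \<in> W \<Longrightarrow> (\<lambda>x. a * f x) \<in> W"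
  by (simp add: fun_subspace_iff)

lemma fun_subspace_diff:
  assumes "fun_subspace W" "f \<in> W" "g \<in> W"
  shows "(\<lambda>x. f x - g x) \<in> W"
  using fun_subspace_add[OF assms(1,2) fun_subspace_smult[OF assms(1,3), of "- 1"]] by simp

lemma fun_subspace_Int:
  assumes "fun_subspace W" "fun_subspace U"
  shows "fun_subspace (W \<inter> U)"
  using assms unfolding fun_subspace_iff by blast

definition supported_on :: "'b set \<Rightarrow> ('b \<Rightarrow> 'f::zero) set" where
  "supported_on F = {f. \<forall>x. x \<notin> F \<longrightarrow> f x = 0}"

lemma fun_subspace_supported_on: "fun_subspace (supported_on F)"
  by (auto simp: fun_subspace_iff supported_on_def)

text \<open>Induction on the support: if some member of \<open>W\<close> does not vanish at \<open>x\<close>, then together with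
  a generating set of the members that vanish at \<open>x\<close> it generates \<open>W\<close>.\<close>

lemma finite_support_finite_span:
  fixes W :: "('b \<Rightarrow> 'f::field) set"
  assumes "finite F" "fun_subspace W" "W \<subseteq> supported_on F"
  shows "\<exists>A. finite A \<and> A \<subseteq> W \<and> W \<subseteq> FS.span A"
  using assms
proof (induction F arbitrary: W rule: finite_induct)
  case empty
  then have "W \<subseteq> {\<lambda>_. 0}" by (auto simp: supported_on_def)
  moreover have "(\<lambda>_. 0) \<in> FS.span {}"
    using fun_subspace_zero[OF FS.span_is_subspace[of "{}"]] by simp
  ultimately show ?case by (intro exI[of _ "{}"]) auto
next
  case (insert x F)
  let ?W = "W \<inter> supported_on F"
  obtain A where A: "finite A" "A \<subseteq> ?W" "?W \<subseteq> FS.span A"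
    using insert.IH[of ?W] fun_subspace_Int[OF insert.prems(1) fun_subspace_supported_on] by blast
  show ?case
  proof (cases "\<exists>w\<in>W. w x \<noteq> 0")
    case False
    then have "W \<subseteq> supported_on F"
      using insert.prems(2) by (fastforce simp: supported_on_def)
    then show ?thesis using A by blast
  next
    case True
    then obtain w where w: "w \<in> W" "w x \<noteq> 0" by blast
    have sp: "fun_subspace (FS.span (insert w A))"
      by (rule FS.span_is_subspace) simp
    have wsp: "w \<in> FS.span (insert w A)" and Asp: "FS.span A \<subseteq> FS.span (insert w A)"
      using FS.in_own_span[of "insert w A"] FS.span_is_monotone[of A "insert w A"] by auto
    have "u \<in> FS.span (insert w A)" if u: "u \<in> W" for u
    proof -
      define c where "c = u x / w x"
      have cw: "(\<lambda>y. c * w y) \<in> W" using fun_subspace_smult[OF insert.prems(1) w(1)] .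
      have d: "(\<lambda>y. u y - c * w y) \<in> W"
        using fun_subspace_diff[OF insert.prems(1) u cw] .
      have "u x - c * w x = 0" using w by (simp add: c_def)
      then have "(\<lambda>y. u y - c * w y) \<in> supported_on F"
        using d insert.prems(2) by (fastforce simp: supported_on_def)
      then have 1: "(\<lambda>y. u y - c * w y) \<in> FS.span (insert w A)" using d A Asp by blast
      have 2: "(\<lambda>y. c * w y) \<in> FS.span (insert w A)" using fun_subspace_smult[OF sp wsp] .
      show ?thesis using fun_subspace_add[OF sp 1 2] by simp
    qed
    then show ?thesis using A w by (intro exI[of _ "insert w A"]) auto
  qed
qed

text \<open>A finite common support rather than a finite spanning set: chains satisfy it at sight, and
  subsets inherit it at once.\<close>

definition fin_subspace :: "('b \<Rightarrow> 'f::field) set \<Rightarrow> bool" where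
  "fin_subspace W \<longleftrightarrow> fun_subspace W \<and> (\<exists>F. finite F \<and> W \<subseteq> supported_on F)"

lemma fin_subspace_mono: "fin_subspace W \<Longrightarrow> fun_subspace U \<Longrightarrow> U \<subseteq> W \<Longrightarrow> fin_subspace U"
  unfolding fin_subspace_def by blast

lemma vectorspace_subspace: "fun_subspace W \<Longrightarrow> vectorspace class_ring (fun_space\<lparr>carrier := W\<rparr>)"
  by (rule FS.subspace_is_vs)

lemma fin_dim_subspace:
  assumes "fin_subspace W"
  shows "vectorspace.fin_dim class_ring (fun_space\<lparr>carrier := W\<rparr>)"
proof -
  have s: "fun_subspace W" using assms by (simp add: fin_subspace_def)
  obtain F where "finite F" "W \<subseteq> supported_on F" using assms by (auto simp: fin_subspace_def)
  from finite_support_finite_span[OF this(1) s this(2)]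
  obtain A where A: "finite A" "A \<subseteq> W" "W \<subseteq> FS.span A" by blast
  have sm: "submodule class_ring W fun_space" using s by (simp add: subspace_def)
  have "LinearCombinations.module.span class_ring (fun_space\<lparr>carrier := W\<rparr>) A = FS.span A"
    by (rule FS.span_li_not_depend(1)[OF A(2) sm])
  moreover have "FS.span A \<subseteq> W" using FS.span_is_subset[OF A(2) sm] by simp
  ultimately show ?thesis
    unfolding vectorspace.fin_dim_def[OF vectorspace_subspace[OF s]] using A by auto
qed

lemma carrier_update_self: "M\<lparr>carrier := carrier M\<rparr> = M"
  by simp

lemma carrier_update_update: "M\<lparr>carrier := U, carrier := W\<rparr> = M\<lparr>carrier := W\<rparr>"
  by simp

text \<open>The target of \<open>T\<close> need not be known to be a vector space: the surjection \<open>T\<close> transports the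
  axioms. This serves quotients of subspaces as well as images.\<close>

lemma rank_nullity_onto:
  fixes W :: "('b \<Rightarrow> 'f::field) set" and Q :: "('f, 'q, 'z) module_scheme"
  assumes W: "fin_subspace W"
    and onto: "T ` W = carrier Q" 
    and add: "\<And>f g. f \<in> W \<Longrightarrow> g \<in> W \<Longrightarrow> T (\<lambda>x. f x + g x) = T f \<oplus>\<^bsub>Q\<^esub> T g"
    and smult: "\<And>a f. f \<in> W \<Longrightarrow> T (\<lambda>x. a * f x) = a \<odot>\<^bsub>Q\<^esub> T f"
    and zero: "T (\<lambda>_. 0) = \<zero>\<^bsub>Q\<^esub>"
  shows "vectorspace.dim class_ring Q + subdim {f \<in> W. T f = \<zero>\<^bsub>Q\<^esub>} = subdim W"
proof -
  let ?W = "fun_space\<lparr>carrier := W\<rparr> :: ('f, 'b \<Rightarrow> 'f) module"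
  have s: "fun_subspace W" using W by (simp add: fin_subspace_def)
  note cl = s[unfolded fun_subspace_iff]
  have TW: "T f \<in> carrier Q" if "f \<in> W" for f using onto that by blast
  have eq: "T f \<oplus>\<^bsub>Q\<^esub> T g = T (\<lambda>x. f x + g x)" if "f \<in> W" "g \<in> W" for f g
    using add that by simp
  have eqs: "a \<odot>\<^bsub>Q\<^esub> T f = T (\<lambda>x. a * f x)" if "f \<in> W" for a f
    using smult that by simp
  have "module class_ring Q"
  proof (rule module_criteria)
    show "cring (class_ring :: 'f ring)" by (rule class_cring.is_cring)
    show "\<zero>\<^bsub>Q\<^esub> \<in> carrier Q" using zero TW cl by metis
    have "\<exists>w\<in>carrier Q. T f \<oplus>\<^bsub>Q\<^esub> w = \<zero>\<^bsub>Q\<^esub>" if f: "f \<in> W" for f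
    proof (rule bexI[of _ "T (\<lambda>x. (- 1) * f x)"])
      have m: "(\<lambda>x. (- 1) * f x) \<in> W" using fun_subspace_smult[OF s f] .
      show "T f \<oplus>\<^bsub>Q\<^esub> T (\<lambda>x. (- 1) * f x) = \<zero>\<^bsub>Q\<^esub>"
        unfolding eq[OF f m] zero[symmetric] by simp
      show "T (\<lambda>x. (- 1) * f x) \<in> carrier Q" using TW m by blast
    qed
    then show "\<forall>v\<in>carrier Q. \<exists>w\<in>carrier Q. v \<oplus>\<^bsub>Q\<^esub> w = \<zero>\<^bsub>Q\<^esub>"
      unfolding onto[symmetric] by blast
  qed (use cl in \<open>auto simp: onto[symmetric] eq eqs zero[symmetric] class_ring_simps algebra_simps
        intro!: arg_cong[of _ _ T]\<close>)
  then have Q: "vectorspace class_ring Q"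
    unfolding vectorspace_def using class_field.field_axioms by blast
  have lm: "linear_map class_ring ?W Q T"
  proof -
    have "T \<in> LinearCombinations.module_hom class_ring ?W Q"
      unfolding LinearCombinations.module_hom_def using add smult TW by auto
    then show ?thesis
      using vectorspace_subspace[OF s] Q \<open>module class_ring Q\<close>
      by (intro linear_map.intro mod_hom.intro mod_hom_axioms.intro)
        (simp_all add: vectorspace.axioms(1))
  qed
  interpret linear_map class_ring ?W Q T by (rule lm)
  have rn: "vectorspace.dim class_ring (Q\<lparr>carrier := imT\<rparr>) + vectorspace.dim class_ring (?W\<lparr>carrier := kerT\<rparr>)
      = vectorspace.dim class_ring ?W"
    by (rule rank_nullity[OF fin_dim_subspace[OF W]])
  have "imT = carrier Q" unfolding im_def using onto by simp
  then have im: "Q\<lparr>carrier := imT\<rparr> = Q" by (rule ssubst) (rule carrier_update_self)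
  have "kerT = {f \<in> W. T f = \<zero>\<^bsub>Q\<^esub>}" unfolding ker_def by simp
  then have ker: "?W\<lparr>carrier := kerT\<rparr> = fun_space\<lparr>carrier := {f \<in> W. T f = \<zero>\<^bsub>Q\<^esub>}\<rparr>"
    by (rule ssubst) (rule carrier_update_update)
  show ?thesis using rn unfolding im ker .
qed

lemma rank_nullity_image:
  fixes W :: "('b \<Rightarrow> 'f::field) set" and T :: "('b \<Rightarrow> 'f) \<Rightarrow> ('c \<Rightarrow> 'f)"
  assumes "fin_subspace W"
    and "\<And>f g. T (\<lambda>x. f x + g x) = (\<lambda>y. T f y + T g y)"
    and "\<And>a f. T (\<lambda>x. a * f x) = (\<lambda>y. a * T f y)"
  shows "subdim (T ` W) + subdim {f \<in> W. T f = (\<lambda>_. 0)} = subdim W"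
proof -
  have "T (\<lambda>_. 0) = (\<lambda>_. 0)" using assms(3)[of 0] by simp
  then show ?thesis
    using rank_nullity_onto[of W T "fun_space\<lparr>carrier := T ` W\<rparr>"] assms by (simp)
qed

lemma fun_subspace_image:
  assumes "fun_subspace W"
    and "\<And>f g. T (\<lambda>x. f x + g x) = (\<lambda>y. T f y + T g y)"
    and "\<And>a f. T (\<lambda>x. a * f x) = (\<lambda>y. a * T f y)"
  shows "fun_subspace (T ` W)"
proof -
  have "T (\<lambda>_. 0) = (\<lambda>_. 0)" using assms(3)[of 0] by simp
  then show ?thesis using assms(1) unfolding fun_subspace_iff
    by (auto simp: assms(2,3)[symmetric] intro: rev_image_eqI)
qed

lemma coset_mem:
  fixes B :: "('b \<Rightarrow> 'f::field) set"
  assumes "fun_subspace B"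
  shows "h \<in> B +>\<^bsub>fun_space\<lparr>carrier := Z\<rparr>\<^esub> z \<longleftrightarrow> (\<lambda>x. h x - z x) \<in> B"
proof -
  have "h \<in> B +>\<^bsub>fun_space\<lparr>carrier := Z\<rparr>\<^esub> z \<longleftrightarrow> (\<exists>b\<in>B. h = (\<lambda>x. b x + z x))"
    by (auto simp: a_r_coset_def r_coset_def)
  also have "\<dots> \<longleftrightarrow> (\<lambda>x. h x - z x) \<in> B"
  proof
    assume "(\<lambda>x. h x - z x) \<in> B"
    then show "\<exists>b\<in>B. h = (\<lambda>x. b x + z x)" by (rule rev_bexI) simp
  qed force
  finally show ?thesis .
qed

text \<open>The two ambient carriers may differ: the map induced by an inclusion compares cosets taken
  among the cycles with cosets taken among all functions.\<close>

lemma coset_eq_iff: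
  fixes B :: "('b \<Rightarrow> 'f::field) set"
  assumes B: "fun_subspace B"
  shows "B +>\<^bsub>fun_space\<lparr>carrier := Z\<rparr>\<^esub> y = B +>\<^bsub>fun_space\<lparr>carrier := Z'\<rparr>\<^esub> z
    \<longleftrightarrow> (\<lambda>x. y x - z x) \<in> B"
proof
  assume "B +>\<^bsub>fun_space\<lparr>carrier := Z\<rparr>\<^esub> y = B +>\<^bsub>fun_space\<lparr>carrier := Z'\<rparr>\<^esub> z"
  moreover have "y \<in> B +>\<^bsub>fun_space\<lparr>carrier := Z\<rparr>\<^esub> y"
    using fun_subspace_zero[OF B] by (simp add: coset_mem[OF B])
  ultimately show "(\<lambda>x. y x - z x) \<in> B" by (simp add: coset_mem[OF B])
next
  assume d: "(\<lambda>x. y x - z x) \<in> B"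
  have "(\<lambda>x. h x - y x) \<in> B \<longleftrightarrow> (\<lambda>x. h x - z x) \<in> B" for h
  proof
    assume "(\<lambda>x. h x - y x) \<in> B"
    from fun_subspace_add[OF B this d] show "(\<lambda>x. h x - z x) \<in> B" by simp
  next
    assume "(\<lambda>x. h x - z x) \<in> B"
    from fun_subspace_diff[OF B this d] show "(\<lambda>x. h x - y x) \<in> B" by simp
  qed
  then show "B +>\<^bsub>fun_space\<lparr>carrier := Z\<rparr>\<^esub> y = B +>\<^bsub>fun_space\<lparr>carrier := Z'\<rparr>\<^esub> z"
    by (intro Set.set_eqI) (simp add: coset_mem[OF B])
qed

text \<open>Rank-nullity for the projection of \<open>Z\<close> onto the cosets of \<open>B\<close>, whose kernel is \<open>B\<close>.\<close>

lemma dim_quotient_space: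
  fixes Z B :: "('b \<Rightarrow> 'f::field) set"
  assumes Z: "fin_subspace Z" and B: "fun_subspace B" and BZ: "B \<subseteq> Z"
  shows "vectorspace.dim class_ring (quotient_space (fun_space\<lparr>carrier := Z\<rparr>) B) + subdim B = subdim Z"
proof -
  let ?V = "fun_space\<lparr>carrier := Z\<rparr>"
  let ?Q = "quotient_space ?V B"
  let ?T = "\<lambda>z. B +>\<^bsub>?V\<^esub> z"
  note mem = coset_mem[OF B]
  have T0: "?T z = B \<longleftrightarrow> z \<in> B" for z
  proof -
    have "B = ?T (\<lambda>_. 0)" by (intro Set.set_eqI) (simp add: mem)
    then show ?thesis using coset_eq_iff[OF B, of Z z Z "\<lambda>_. 0"] by simp
  qed
  have self: "z \<in> ?T z" for z by (simp add: mem fun_subspace_zero[OF B])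
  have "vectorspace.dim class_ring ?Q + subdim {z \<in> Z. ?T z = \<zero>\<^bsub>?Q\<^esub>} = subdim Z"
  proof (rule rank_nullity_onto[OF Z])
    show "?T ` Z = carrier ?Q"
      by (auto simp: quotient_space_def A_RCOSETS_def RCOSETS_def a_r_coset_def)
    show "?T (\<lambda>_. 0) = \<zero>\<^bsub>?Q\<^esub>" using T0 fun_subspace_zero[OF B] by (simp add: quotient_space_def)
    fix f g :: "'b \<Rightarrow> 'f" and a
    have add_eq: "C \<oplus>\<^bsub>?Q\<^esub> D = {\<lambda>x. c x + d x | c d. c \<in> C \<and> d \<in> D}" for C D
      by (auto simp: quotient_space_def set_add_def set_mult_def)
    have smult_eq: "a \<odot>\<^bsub>?Q\<^esub> C = (\<Union>c\<in>C. ?T (\<lambda>x. a * c x))" for C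
      by (simp add: quotient_space_def fun_space_def)
    show "?T (\<lambda>x. f x + g x) = ?T f \<oplus>\<^bsub>?Q\<^esub> ?T g"
    proof (intro equalityI subsetI)
      fix h assume "h \<in> ?T (\<lambda>x. f x + g x)"
      then have "(\<lambda>x. h x - g x) \<in> ?T f" by (simp add: mem algebra_simps)
      then show "h \<in> ?T f \<oplus>\<^bsub>?Q\<^esub> ?T g"
        unfolding add_eq using self[of g] by (intro CollectI exI[of _ "\<lambda>x. h x - g x"] exI[of _ g]) simp
    next
      fix h assume "h \<in> ?T f \<oplus>\<^bsub>?Q\<^esub> ?T g"
      then obtain c d where cd: "c \<in> ?T f" "d \<in> ?T g" "h = (\<lambda>x. c x + d x)"
        unfolding add_eq by blast
      then show "h \<in> ?T (\<lambda>x. f x + g x)"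
        using fun_subspace_add[OF B, of "\<lambda>x. c x - f x" "\<lambda>x. d x - g x"]
        by (simp add: mem algebra_simps)
    qed
    have "?T (\<lambda>x. a * h x) = ?T (\<lambda>x. a * f x)" if "h \<in> ?T f" for h
      using that fun_subspace_smult[OF B, of "\<lambda>x. h x - f x" a]
      by (simp add: coset_eq_iff[OF B] mem algebra_simps)
    then show "?T (\<lambda>x. a * f x) = a \<odot>\<^bsub>?Q\<^esub> ?T f"
      unfolding smult_eq using self[of f] by blast
  qed
  moreover have "{z \<in> Z. ?T z = \<zero>\<^bsub>?Q\<^esub>} = B" using T0 BZ by (auto simp: quotient_space_def)
  ultimately show ?thesis by simp
qed

lemma subdim_mono:
  assumes "fin_subspace W" "fun_subspace U" "U \<subseteq> W"
  shows "subdim U \<le> subdim W"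
  using dim_quotient_space[OF assms] by simp

lemma subdim_eq_imp_eq:
  fixes W :: "('b \<Rightarrow> 'f::field) set"
  assumes W: "fin_subspace W" and U: "fun_subspace U" and UW: "U \<subseteq> W" and d: "subdim U = subdim W"
  shows "U = W"
proof -
  have s: "fun_subspace W" using W by (simp add: fin_subspace_def)
  have fU: "fin_subspace U" using fin_subspace_mono[OF W U UW] .
  interpret W: vectorspace class_ring "fun_space\<lparr>carrier := W\<rparr>" by (rule vectorspace_subspace[OF s])
  interpret U: vectorspace class_ring "fun_space\<lparr>carrier := U\<rparr>" by (rule vectorspace_subspace[OF U])
  have smU: "submodule class_ring U fun_space" and smW: "submodule class_ring W fun_space"
    using U s by (simp_all add: subspace_def)
  obtain A where A: "finite A" "U.basis A"
    using U.finite_basis_exists[OF fin_dim_subspace[OF fU]] by blast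
  have AU: "A \<subseteq> U" and li: "U.lin_indpt A" and gen: "U.span A = U"
    using A(2) unfolding U.basis_def by auto
  have AW: "A \<subseteq> W" using AU UW by blast
  have "W.lin_indpt A"
    using li FS.span_li_not_depend(2)[OF AU smU] FS.span_li_not_depend(2)[OF AW smW] by simp
  moreover have "card A = W.dim" using U.dim_basis[OF A] d by simp
  ultimately have "W.basis A"
    using W.dim_li_is_basis[OF fin_dim_subspace[OF W] A(1)] AW by simp
  then have "W.span A = W" unfolding W.basis_def by simp
  then show ?thesis
    using gen FS.span_li_not_depend(1)[OF AU smU] FS.span_li_not_depend(1)[OF AW smW] by simp
qed

lemma subdim_zero: "subdim {\<lambda>_ :: 'b. 0 :: 'f::field} = 0"
proof -
  let ?Z = "{\<lambda>_ :: 'b. 0 :: 'f}"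
  have s: "fun_subspace ?Z" by (simp add: fun_subspace_iff)
  have "fin_subspace ?Z"
    unfolding fin_subspace_def using s by (auto simp: supported_on_def intro!: exI[of _ "{}"])
  then have "subdim ((\<lambda>c. c) ` ?Z) + subdim {c \<in> ?Z. c = (\<lambda>_. 0)} = subdim ?Z"
    by (rule rank_nullity_image[where T = "\<lambda>c. c"]) (rule refl)+
  moreover have "{c \<in> ?Z. c = (\<lambda>_. 0)} = ?Z" by auto
  ultimately show ?thesis by simp
qed

section \<open>Alternating chains, contraction and augmented boundary\<close>

text \<open>Alternating chains on the faces with \<open>n\<close> vertices. Counting vertices instead of dimension
  brings in the empty face (\<open>n = 0\<close>), hence the augmented complex. Links need it: adding a vertex
  shifts the dimension by one and turns the empty face of the link into the new vertex.\<close>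

definition face_chains :: "'v set set \<Rightarrow> nat \<Rightarrow> ('v list \<Rightarrow> 'f::field) set" where
  "face_chains X n = {c.
     (\<forall>vs. c vs \<noteq> 0 \<longrightarrow> length vs = n \<and> distinct vs \<and> set vs \<in> X) \<and>
     (\<forall>vs \<pi>. \<pi> permutes {..<length vs} \<longrightarrow> c (permute_list \<pi> vs) = of_int (sign \<pi>) * c vs)}"

text \<open>Removal of \<open>v\<close> from the front. This is the projection of the chains of a complex onto the
  relative chains modulo the faces without \<open>v\<close>, written as chains of the link.\<close>

definition contraction :: "'v \<Rightarrow> ('v list \<Rightarrow> 'f) \<Rightarrow> 'v list \<Rightarrow> 'f" where
  "contraction v c = (\<lambda>vs. c (v # vs))"

text \<open>In contrast to \<open>boundary_op\<close>, the value on the empty list is the augmentation. The set of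
  vertices is a parameter so that one operator serves a complex and all its subcomplexes.\<close>

definition aug_boundary :: "'v set \<Rightarrow> ('v list \<Rightarrow> 'f::field) \<Rightarrow> 'v list \<Rightarrow> 'f" where
  "aug_boundary V c = (\<lambda>vs. \<Sum>v\<in>V. c (v # vs))"

lemma oriented_chains_eq: "oriented_chains X i = face_chains X (Suc i)"
  by (simp add: oriented_chains_def face_chains_def)

lemma face_chainsD:
  assumes "c \<in> face_chains X n"
  shows "c vs \<noteq> 0 \<Longrightarrow> length vs = n" "c vs \<noteq> 0 \<Longrightarrow> distinct vs" "c vs \<noteq> 0 \<Longrightarrow> set vs \<in> X"
    "\<pi> permutes {..<length vs} \<Longrightarrow> c (permute_list \<pi> vs) = of_int (sign \<pi>) * c vs"
  using assms by (auto simp: face_chains_def)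

lemma face_chains_mono: "X \<subseteq> Y \<Longrightarrow> face_chains X n \<subseteq> face_chains Y n"
  by (auto simp: face_chains_def)

lemma fun_subspace_face_chains: "fun_subspace (face_chains X n :: ('v list \<Rightarrow> 'f::field) set)"
  unfolding fun_subspace_iff
proof (intro conjI ballI allI)
  fix c d :: "'v list \<Rightarrow> 'f" and a
  assume c: "c \<in> face_chains X n"
  show "(\<lambda>x. a * c x) \<in> face_chains X n"
    using c by (auto simp: face_chains_def)
  assume d: "d \<in> face_chains X n"
  have "c vs \<noteq> 0 \<or> d vs \<noteq> 0" if "c vs + d vs \<noteq> 0" for vs using that by auto
  then show "(\<lambda>x. c x + d x) \<in> face_chains X n"
    using c d by (fastforce simp: face_chains_def distrib_left)
qed (simp add: face_chains_def)

lemma fin_subspace_face_chains: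
  assumes "simplicial_complex X"
  shows "fin_subspace (face_chains X n :: ('v list \<Rightarrow> 'f::field) set)"
proof -
  have fin: "finite (\<Union>X)" using assms by (auto simp: simplicial_complex_def)
  have "face_chains X n \<subseteq> supported_on {vs. set vs \<subseteq> \<Union>X \<and> length vs = n}"
    by (auto simp: face_chains_def supported_on_def)
  then show ?thesis
    using fun_subspace_face_chains finite_lists_length_eq[OF fin, of n] unfolding fin_subspace_def by metis
qed

text \<open>The shifted permutation fixes the position \<open>0\<close>, and conjugation by the shift keeps the sign.\<close>

lemma extend_tail_permutation:
  assumes p: "p permutes {..<length vs}"
  obtains q where "q permutes {..<length (v # vs)}" "sign q = sign p"
    "permute_list q (v # vs) = v # permute_list p vs"
proof
  define q where "q = map_permutation {..<length vs} Suc p"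
  have "q permutes (Suc ` {..<length vs})"
    unfolding q_def by (rule map_permutation_permutes[OF _ p]) (simp add: bij_betw_def)
  then show q: "q permutes {..<length (v # vs)}"
    by (rule permutes_subset) auto
  show "sign q = sign p"
    unfolding q_def by (rule sign_map_permutation) (use p in auto)
  have "q (Suc i) = Suc (p i)" if "i < length vs" for i
    unfolding q_def using that by (subst map_permutation_apply) (auto)
  moreover have "q 0 = 0"
    unfolding q_def by (simp add: map_permutation_def)
  ultimately show "permute_list q (v # vs) = v # permute_list p vs"
    by (auto simp: permute_list_def map_upt_Suc simp del: upt_Suc)
qed

lemma face_chains_permute_tail:
  assumes c: "c \<in> face_chains X n" and p: "p permutes {..<length vs}"
  shows "c (v # permute_list p vs) = of_int (sign p) * c (v # vs)"
proof -
  obtain q where "q permutes {..<length (v # vs)}" "sign q = sign p"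
    "permute_list q (v # vs) = v # permute_list p vs"
    using extend_tail_permutation[OF p] by blast
  then show ?thesis using face_chainsD(4)[OF c, of q "v # vs"] by simp
qed

lemma face_chains_swap:
  assumes c: "c \<in> face_chains X n"
  shows "c (v # w # vs) = - c (w # v # vs)"
proof -
  let ?t = "Transposition.transpose 0 (Suc 0)"
  have t: "?t permutes {..<length (w # v # vs)}" by (rule permutes_swap_id) auto
  have "permute_list ?t (w # v # vs) = v # w # vs"
    by (rule nth_equalityI)
      (auto simp: permute_list_def nth_Cons transpose_def split: nat.splits simp del: upt_Suc)
  then show ?thesis using face_chainsD(4)[OF c t] by (simp add: sign_swap_id)
qed

lemma contraction_face_chains:
  assumes c: "c \<in> face_chains X (Suc n)"
  shows "contraction v c \<in> face_chains (link v X) n"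
proof -
  have "length vs = n \<and> distinct vs \<and> set vs \<in> link v X" if "c (v # vs) \<noteq> 0" for vs
    using face_chainsD(1-3)[OF c that] by (simp add: link_def)
  then show ?thesis
    using face_chains_permute_tail[OF c] by (simp add: face_chains_def contraction_def)
qed

lemma aug_boundary_face_chains:
  assumes X: "simplicial_complex X" and c: "c \<in> face_chains X (Suc n)"
  shows "aug_boundary V c \<in> face_chains X n"
proof -
  have "length vs = n \<and> distinct vs \<and> set vs \<in> X" if "aug_boundary V c vs \<noteq> 0" for vs
  proof -
    obtain v where v: "c (v # vs) \<noteq> 0"
      using \<open>aug_boundary V c vs \<noteq> 0\<close> unfolding aug_boundary_def by (meson sum.neutral)
    then have "set (v # vs) \<in> X" "set vs \<subseteq> set (v # vs)" using face_chainsD(3)[OF c v] by auto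
    then have "set vs \<in> X" using X unfolding simplicial_complex_def by blast
    then show ?thesis using v face_chainsD(1,2)[OF c v] by simp
  qed
  then show ?thesis
    using face_chains_permute_tail[OF c]
    by (auto simp: face_chains_def aug_boundary_def sum_distrib_left)
qed

text \<open>Terms cancel in pairs, which stays correct in characteristic two because the diagonal
  vanishes.\<close>

lemma sum_antisymmetric_eq_0:
  fixes g :: "'a \<Rightarrow> 'a \<Rightarrow> 'b::ab_group_add"
  assumes "finite V" "\<And>v. g v v = 0" "\<And>v w. g v w = - g w v"
  shows "(\<Sum>v\<in>V. \<Sum>w\<in>V. g v w) = 0"
  using assms(1)
proof (induction V rule: finite_induct)
  case (insert x V)
  have "(\<Sum>v\<in>V. g v x) = - (\<Sum>v\<in>V. g x v)"
    using assms(3) by (metis sum_negf sum.cong)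
  then show ?case using insert assms(2) by (simp add: sum.distrib)
qed simp

lemma aug_boundary_aug_boundary:
  assumes "finite V" and c: "c \<in> face_chains X n"
  shows "aug_boundary V (aug_boundary V c) = (\<lambda>_. 0)"
proof
  fix vs
  have "c (w # w # vs) = 0" for w using face_chainsD(2)[OF c, of "w # w # vs"] by auto
  then show "aug_boundary V (aug_boundary V c) vs = 0"
    unfolding aug_boundary_def
    using sum_antisymmetric_eq_0[OF assms(1), of "\<lambda>v w. c (w # v # vs)"] face_chains_swap[OF c] by blast
qed

text \<open>Contraction is a chain map up to sign: the boundary inserts its vertex in front of \<open>v\<close>, the
  boundary in the link behind it.\<close>

lemma contraction_aug_boundary:
  assumes c: "c \<in> face_chains X n"
  shows "contraction v (aug_boundary V c) = (\<lambda>vs. - aug_boundary V (contraction v c) vs)"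
  unfolding contraction_def aug_boundary_def sum_negf[symmetric]
  by (intro ext sum.cong refl face_chains_swap[OF c])

lemma permute_to_front:
  assumes "v \<in> set vs"
  obtains p where "p permutes {..<length vs}" "permute_list p vs = v # remove1 v vs"
proof -
  have "mset (v # remove1 v vs) = mset vs" using assms by simp
  then show ?thesis using mset_eq_permutation that by metis
qed

lemma face_chains_contraction_zero:
  assumes c: "c \<in> face_chains (induced X (insert v A)) n" and 0: "contraction v c = (\<lambda>_. 0)"
  shows "c \<in> face_chains (induced X A) n"
proof -
  have "v \<notin> set vs" if "c vs \<noteq> 0" for vs
  proof
    assume "v \<in> set vs"
    then obtain p where p: "p permutes {..<length vs}" "permute_list p vs = v # remove1 v vs"
      by (rule permute_to_front)
    have "c (permute_list p vs) = 0" using 0 p(2) by (simp add: contraction_def fun_eq_iff)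
    then have "of_int (sign p) * c vs = 0" using face_chainsD(4)[OF c p(1)] by simp
    then show False using that by (cases p rule: sign_cases) auto
  qed
  then show ?thesis using c by (auto simp: face_chains_def induced_def)
qed

text \<open>A chain \<open>e\<close> of the link extends to the chain whose value on a list that contains \<open>v\<close> is found
  by moving \<open>v\<close> to the front. Two ways of doing so differ by a permutation of the tail, so the
  choice does not matter because \<open>e\<close> is alternating.\<close>

lemma contraction_surj:
  fixes e :: "'v list \<Rightarrow> 'f::field"
  assumes e: "e \<in> face_chains (link v X) n"
  shows "\<exists>c\<in>face_chains X (Suc n). contraction v c = e"
proof -
  define P where "P = (\<lambda>vs p. p permutes {..<length vs} \<and> permute_list p vs = v # remove1 v vs)"
  define c :: "'v list \<Rightarrow> 'f" where
    "c = (\<lambda>vs. if v \<in> set vs \<and> distinct vs then of_int (sign (SOME p. P vs p)) * e (remove1 v vs) else 0)"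
  have val: "c vs = of_int (sign q) * e (tl (permute_list q vs))"
    if vs: "v \<in> set vs" "distinct vs" and q: "q permutes {..<length vs}" "hd (permute_list q vs) = v" for vs q
  proof -
    define p where "p = (SOME p. P vs p)"
    have "\<exists>p. P vs p" using permute_to_front[OF vs(1)] unfolding P_def by metis
    then have "P vs p" unfolding p_def by (rule someI_ex)
    then have p: "p permutes {..<length vs}" "permute_list p vs = v # remove1 v vs"
      unfolding P_def by auto
    define us where "us = tl (permute_list q vs)"
    have "vs \<noteq> []" using vs(1) by auto
    then have qus: "permute_list q vs = v # us"
      unfolding us_def using q(2) by (metis length_0_conv length_permute_list list.collapse)
    have len: "length us = length vs - 1" using arg_cong[OF qus, of length] by simp
    have "mset (v # us) = mset (v # remove1 v vs)"
      unfolding qus[symmetric] p(2)[symmetric] using p(1) q(1) by simp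
    then have "mset us = mset (remove1 v vs)" by simp
    then obtain r where r: "r permutes {..<length (remove1 v vs)}" "permute_list r (remove1 v vs) = us"
      using mset_eq_permutation by metis
    \<comment> \<open>\<open>p\<close> and \<open>q\<close> both move \<open>v\<close> to the front; they differ by \<open>s\<close>, which permutes the tail.\<close>
    obtain s where s: "s permutes {..<length (v # remove1 v vs)}" "sign s = sign r"
      "permute_list s (v # remove1 v vs) = v # us"
      using extend_tail_permutation[OF r(1), of v] r(2) by metis
    have lenp: "length (v # remove1 v vs) = length vs" using arg_cong[OF p(2), of length] by simp
    have s': "s permutes {..<length vs}" using s(1) lenp by simp
    have "permute_list (p \<circ> s) vs = permute_list q vs"
      using permute_list_compose[OF s', of p] s(3) p(2) qus by simp
    then have "(p \<circ> s) i = q i" if "i < length vs" for i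
    proof -
      have "vs ! ((p \<circ> s) i) = vs ! (q i)"
        using \<open>permute_list (p \<circ> s) vs = permute_list q vs\<close> that permute_list_nth[OF q(1) that]
          permute_list_nth[OF permutes_compose[OF s' p(1)] that] by metis
      moreover have "(p \<circ> s) i < length vs" "q i < length vs"
        using permutes_in_image[OF q(1)] permutes_in_image[OF permutes_compose[OF s' p(1)]] that
        by (metis lessThan_iff)+
      ultimately show ?thesis using vs(2) nth_eq_iff_index_eq by metis
    qed
    moreover have "(p \<circ> s) i = q i" if "\<not> i < length vs" for i
      using that permutes_not_in[OF q(1)] permutes_not_in[OF permutes_compose[OF s' p(1)]] by (metis lessThan_iff)
    ultimately have "q = p \<circ> s" by (metis ext)
    then have "sign q = sign p * sign r"
      using s(2) sign_compose[OF permutes_imp_permutation[OF _ p(1)] permutes_imp_permutation[OF _ s']] by simp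
    moreover have "e us = of_int (sign r) * e (remove1 v vs)"
      using face_chainsD(4)[OF e r(1)] r(2) by simp
    moreover have "c vs = of_int (sign p) * e (remove1 v vs)"
      unfolding c_def p_def using vs by simp
    ultimately show ?thesis unfolding us_def[symmetric]
      by (cases r rule: sign_cases) auto
  qed
  have "c \<in> face_chains X (Suc n)"
    unfolding face_chains_def
  proof (intro CollectI conjI allI impI)
    fix vs assume nz: "c vs \<noteq> 0"
    then have v: "v \<in> set vs" "distinct vs" "e (remove1 v vs) \<noteq> 0"
      unfolding c_def by (auto split: if_splits)
    have len: "length (remove1 v vs) = n" and lk: "set (remove1 v vs) \<in> link v X"
      using face_chainsD(1,3)[OF e v(3)] by auto
    then show "length vs = Suc n" using v(1) by (simp add: length_remove1) (metis Suc_pred length_pos_if_in_set)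
    show "distinct vs" by (rule v(2))
    have "insert v (set vs - {v}) = set vs" using v(1) by auto
    then show "set vs \<in> X" using lk v(2) by (simp add: link_def)
  next
    fix vs :: "'v list" and p :: "nat \<Rightarrow> nat" assume p: "p permutes {..<length vs}"
    show "c (permute_list p vs) = of_int (sign p) * c vs"
    proof (cases "v \<in> set vs \<and> distinct vs")
      case False
      then have "\<not> (v \<in> set (permute_list p vs) \<and> distinct (permute_list p vs))" using p by simp
      then show ?thesis using False unfolding c_def by (simp only: if_False mult_zero_right)
    next
      case True
      define ws where "ws = permute_list p vs"
      have ws: "v \<in> set ws" "distinct ws" "length ws = length vs" using True p by (simp_all add: ws_def)
      obtain q where q: "q permutes {..<length ws}" "permute_list q ws = v # remove1 v ws"
        using permute_to_front[OF ws(1)] by blast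
      have q': "q permutes {..<length vs}" using q(1) ws(3) by simp
      have comp: "permute_list (p \<circ> q) vs = permute_list q ws"
        using permute_list_compose[OF q', of p] by (simp add: ws_def)
      have "c ws = of_int (sign q) * e (remove1 v ws)"
        using val[OF ws(1,2) q(1)] q(2) by simp
      moreover have "c vs = of_int (sign (p \<circ> q)) * e (remove1 v ws)"
        using val[of vs "p \<circ> q"] True permutes_compose[OF q' p] comp q(2) by simp
      moreover have "sign (p \<circ> q) = sign p * sign q"
        by (rule sign_compose[OF permutes_imp_permutation[OF _ p] permutes_imp_permutation[OF _ q']]) auto
      ultimately show ?thesis unfolding ws_def[symmetric]
        by (cases p rule: sign_cases) auto
    qed
  qed
  moreover have "contraction v c = e"
  proof
    fix us
    show "contraction v c us = e us"
    proof (cases "distinct (v # us)")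
      case True
      then show ?thesis using val[of "v # us" id] by (simp add: contraction_def permutes_id)
    next
      case False
      then have "e us = 0" using face_chainsD(2,3)[OF e, of us] by (auto simp: link_def)
      then show ?thesis using False by (simp add: contraction_def c_def)
    qed
  qed
  ultimately show ?thesis by blast
qed

lemma contraction_linear:
  "contraction v (\<lambda>x. f x + g x) = (\<lambda>y. contraction v f y + contraction v g y)"
  "contraction v (\<lambda>x. a * f x) = (\<lambda>y. a * contraction v f y)"
  by (simp_all add: contraction_def)

lemma aug_boundary_linear:
  "aug_boundary V (\<lambda>x. f x + g x) = (\<lambda>y. aug_boundary V f y + aug_boundary V g y)"
  "aug_boundary V (\<lambda>x. a * f x) = (\<lambda>y. a * aug_boundary V f y)"
  by (simp_all add: aug_boundary_def sum.distrib sum_distrib_left)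

section \<open>Betti numbers from ranks\<close>

definition aug_boundaries :: "'v set set \<Rightarrow> nat \<Rightarrow> ('v list \<Rightarrow> 'f::field) set" where
  "aug_boundaries X n = aug_boundary (vertices X) ` face_chains X (Suc n)"

definition chain_dim :: "'f::field itself \<Rightarrow> 'v set set \<Rightarrow> nat \<Rightarrow> nat" where
  "chain_dim F X n = subdim (face_chains X n :: ('v list \<Rightarrow> 'f) set)"

definition boundary_rank :: "'f::field itself \<Rightarrow> 'v set set \<Rightarrow> nat \<Rightarrow> nat" where
  "boundary_rank F X n = subdim (aug_boundaries X n :: ('v list \<Rightarrow> 'f) set)"

lemma finite_vertices: "simplicial_complex X \<Longrightarrow> finite (vertices X)"
  by (rule finite_subset[of _ "\<Union>X"]) (auto simp: simplicial_complex_def vertices_def)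

lemma vertex_of_face: "simplicial_complex X \<Longrightarrow> \<alpha> \<in> X \<Longrightarrow> v \<in> \<alpha> \<Longrightarrow> v \<in> vertices X"
  unfolding simplicial_complex_def vertices_def by blast

text \<open>A vertex outside \<open>X\<close> only contributes lists on which \<open>c\<close> vanishes.\<close>

lemma aug_boundary_cong:
  assumes X: "simplicial_complex X" and c: "c \<in> face_chains X n"
    and V: "finite V" "vertices X \<subseteq> V"
  shows "aug_boundary V c = aug_boundary (vertices X) c"
proof
  fix vs
  have "c (v # vs) = 0" if "v \<in> V - vertices X" for v
  proof (rule ccontr)
    assume "c (v # vs) \<noteq> 0"
    then have "set (v # vs) \<in> X" using face_chainsD(3)[OF c] by blast
    then show False using that vertex_of_face[OF X] by (metis DiffD2 list.set_intros(1))
  qed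
  then show "aug_boundary V c vs = aug_boundary (vertices X) c vs"
    unfolding aug_boundary_def by (intro sum.mono_neutral_right[OF V]) blast
qed

lemma aug_boundaries_eq:
  assumes "simplicial_complex X" "finite V" "vertices X \<subseteq> V"
  shows "aug_boundaries X n = aug_boundary V ` face_chains X (Suc n)"
  unfolding aug_boundaries_def
  by (rule image_cong[OF refl]) (use aug_boundary_cong[OF assms(1) _ assms(2,3)] in metis)

lemma fun_subspace_aug_boundaries: "fun_subspace (aug_boundaries X n)"
  unfolding aug_boundaries_def
  by (rule fun_subspace_image[OF fun_subspace_face_chains]) (simp_all add: aug_boundary_linear)

lemma aug_boundaries_subset: "simplicial_complex X \<Longrightarrow> aug_boundaries X n \<subseteq> face_chains X n"
  unfolding aug_boundaries_def using aug_boundary_face_chains by blast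

lemma fin_subspace_aug_boundaries: "simplicial_complex X \<Longrightarrow> fin_subspace (aug_boundaries X n)"
  using fin_subspace_mono[OF fin_subspace_face_chains fun_subspace_aug_boundaries aug_boundaries_subset] by blast

lemma aug_boundaries_mono:
  assumes "simplicial_complex X" "simplicial_complex Y" "X \<subseteq> Y"
  shows "aug_boundaries X n \<subseteq> aug_boundaries Y n"
proof -
  have "vertices X \<subseteq> vertices Y" using assms(3) by (auto simp: vertices_def)
  then show ?thesis
    using aug_boundaries_eq[OF assms(1) finite_vertices[OF assms(2)]] face_chains_mono[OF assms(3)]
    unfolding aug_boundaries_def by blast
qed

text \<open>For \<open>n = 1\<close> the two operators differ by the augmentation, which unreduced homology omits.\<close>

lemma boundary_op_eq:
  assumes c: "c \<in> face_chains X n" and "n \<noteq> 1"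
  shows "boundary_op X c = aug_boundary (vertices X) c"
proof -
  have "c [v] = 0" for v using face_chainsD(1)[OF c, of "[v]"] assms(2) by auto
  then show ?thesis by (auto simp: boundary_op_def aug_boundary_def)
qed

lemma boundaries_eq: "boundaries X i = aug_boundaries X (Suc i)"
  unfolding boundaries_def aug_boundaries_def oriented_chains_eq
  by (rule image_cong[OF refl]) (rule boundary_op_eq, auto)

lemma cycles_0: "cycles X 0 = (face_chains X 1 :: ('v list \<Rightarrow> 'f::field) set)"
proof -
  have "boundary_op X c = (\<lambda>_. 0)" if c: "c \<in> face_chains X 1" for c :: "'v list \<Rightarrow> 'f"
  proof -
    have "c (v # vs) = 0" if "vs \<noteq> []" for v vs using face_chainsD(1)[OF c, of "v # vs"] that by auto
    then show ?thesis by (auto simp: boundary_op_def)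
  qed
  then show ?thesis by (auto simp: cycles_def oriented_chains_eq)
qed

lemma cycles_Suc:
  "cycles X (Suc i) = {c \<in> face_chains X (Suc (Suc i)). aug_boundary (vertices X) c = (\<lambda>_. 0 :: 'f::field)}"
proof -
  have "boundary_op X c = aug_boundary (vertices X) c"
    if "c \<in> face_chains X (Suc (Suc i))" for c :: "'a list \<Rightarrow> 'f"
    by (rule boundary_op_eq[OF that]) simp
  then show ?thesis by (auto simp: cycles_def oriented_chains_eq)
qed

lemma boundaries_subset_cycles:
  fixes X :: "'v set set"
  assumes X: "simplicial_complex X"
  shows "boundaries X i \<subseteq> (cycles X i :: ('v list \<Rightarrow> 'f::field) set)"
proof (cases i)
  case 0
  then show ?thesis unfolding boundaries_eq 0 cycles_0 using aug_boundaries_subset[OF X] by simp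
next
  case (Suc k)
  have "aug_boundary (vertices X) c = (\<lambda>_. 0)" if "c \<in> aug_boundaries X (Suc i)" for c :: "'v list \<Rightarrow> 'f"
    using that aug_boundary_aug_boundary[OF finite_vertices[OF X]] unfolding aug_boundaries_def by blast
  then show ?thesis
    unfolding Suc cycles_Suc boundaries_eq using aug_boundaries_subset[OF X, of "Suc (Suc k)"] Suc by auto
qed

lemma fun_subspace_cycles: "fun_subspace (cycles X i)"
proof (cases i)
  case 0
  then show ?thesis by (simp add: cycles_0 fun_subspace_face_chains)
next
  case (Suc k)
  have "aug_boundary (vertices X) (\<lambda>_. 0) = (\<lambda>_. 0)" by (simp add: aug_boundary_def)
  then show ?thesis
    using fun_subspace_face_chains[of X "Suc (Suc k)"]
    unfolding Suc cycles_Suc fun_subspace_iff by (auto simp: aug_boundary_linear)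
qed

lemma cycles_subset: "cycles X i \<subseteq> face_chains X (Suc i)"
  by (auto simp: cycles_def oriented_chains_eq)

text \<open>The Betti number is the dimension of the cycles minus that of the boundaries, and rank-nullity
  for the boundary operator gives the dimension of the cycles. In degree zero every chain is a cycle,
  so the rank of the augmentation is not subtracted.\<close>

lemma betti_formula:
  fixes X :: "'v set set" and F :: "'f::field itself"
  assumes X: "simplicial_complex X"
  shows "betti F X i + boundary_rank F X (Suc i) + (if i = 0 then 0 else boundary_rank F X i)
    = chain_dim F X (Suc i)"
proof -
  let ?Z = "cycles X i :: ('v list \<Rightarrow> 'f) set"
  have Z: "fin_subspace ?Z"
    by (rule fin_subspace_mono[OF fin_subspace_face_chains[OF X] fun_subspace_cycles cycles_subset])
  have "betti F X i + boundary_rank F X (Suc i) = subdim ?Z"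
    unfolding betti_def homology_def boundary_rank_def boundaries_eq
    using dim_quotient_space[OF Z fun_subspace_aug_boundaries[of X "Suc i"]] boundaries_subset_cycles[OF X, of i]
    by (simp add: boundaries_eq)
  moreover have "subdim ?Z + (if i = 0 then 0 else boundary_rank F X i) = chain_dim F X (Suc i)"
  proof (cases i)
    case 0
    then show ?thesis by (simp add: cycles_0 chain_dim_def)
  next
    case (Suc k)
    let ?C = "face_chains X (Suc i) :: ('v list \<Rightarrow> 'f) set"
    have "subdim (aug_boundary (vertices X) ` ?C)
       + subdim {c \<in> ?C. aug_boundary (vertices X) c = (\<lambda>_. 0)} = subdim ?C"
      by (rule rank_nullity_image[OF fin_subspace_face_chains[OF X]]) (simp_all add: aug_boundary_linear)
    then show ?thesis
      unfolding chain_dim_def boundary_rank_def aug_boundaries_def Suc cycles_Suc by simp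
  qed
  ultimately show ?thesis by simp
qed

lemma simplicial_complex_induced: "simplicial_complex X \<Longrightarrow> simplicial_complex (induced X A)"
  unfolding simplicial_complex_def induced_def by auto

lemma induced_mono: "A \<subseteq> B \<Longrightarrow> induced X A \<subseteq> induced X B"
  by (auto simp: induced_def)

lemma simplicial_complex_link:
  assumes X: "simplicial_complex X" and v: "v \<in> vertices X"
  shows "simplicial_complex (link v X)"
proof -
  have "link v X \<subseteq> Pow (\<Union>X)" by (auto simp: link_def)
  moreover have "finite (\<Union>X)" using X by (auto simp: simplicial_complex_def)
  ultimately have "finite (link v X)" by (meson finite_Pow_iff finite_subset)
  moreover have "\<beta> \<in> link v X" if "\<alpha> \<in> link v X" "\<beta> \<subseteq> \<alpha>" for \<alpha> \<beta>
  proof -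
    have "insert v \<alpha> \<in> X" "insert v \<beta> \<subseteq> insert v \<alpha>" "v \<notin> \<beta>" using that by (auto simp: link_def)
    then show ?thesis using X unfolding simplicial_complex_def link_def by blast
  qed
  moreover have "finite \<alpha>" if "\<alpha> \<in> link v X" for \<alpha>
    using that X unfolding simplicial_complex_def link_def by (metis finite_insert mem_Collect_eq)
  moreover have "{} \<in> link v X" using v by (simp add: link_def vertices_def)
  ultimately show ?thesis unfolding simplicial_complex_def by blast
qed

section \<open>Adding a vertex to an induced subcomplex\<close>

text \<open>The exact sequence of chains: the chains of \<open>induced X A\<close> are those chains of
  \<open>induced X (insert v A)\<close> that the contraction by \<open>v\<close> kills, and its image consists of all chains
  of the link of \<open>v\<close>, one degree lower.\<close>

context
  fixes X :: "'v set set" and v A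
  assumes X: "simplicial_complex X" and v: "v \<in> vertices X" and vA: "v \<notin> A"
begin

abbreviation (input) "old \<equiv> induced X A"
abbreviation (input) "new \<equiv> induced X (insert v A)"
abbreviation (input) "lk \<equiv> link v (induced X (insert v A))"

lemma simplicial_old: "simplicial_complex old" and simplicial_new: "simplicial_complex new"
  using simplicial_complex_induced[OF X] by auto

lemma v_in_new: "v \<in> vertices new"
  using v by (simp add: vertices_def induced_def)

lemma simplicial_lk: "simplicial_complex lk"
  by (rule simplicial_complex_link[OF simplicial_new v_in_new])

lemma contraction_image: "contraction v ` face_chains new (Suc n) = (face_chains lk n :: ('v list \<Rightarrow> 'f::field) set)"
proof (intro equalityI subsetI)
  fix e :: "'v list \<Rightarrow> 'f" assume "e \<in> face_chains lk n"
  then show "e \<in> contraction v ` face_chains new (Suc n)" by (auto dest!: contraction_surj)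
qed (auto intro: contraction_face_chains)

lemma contraction_kernel:
  "{c \<in> face_chains new n. contraction v c = (\<lambda>_. 0)} = (face_chains old n :: ('v list \<Rightarrow> 'f::field) set)"
proof (intro equalityI subsetI)
  fix c :: "'v list \<Rightarrow> 'f" assume c: "c \<in> face_chains old n"
  have "c (v # vs) = 0" for vs
    using face_chainsD(3)[OF c, of "v # vs"] vA by (auto simp: induced_def)
  then show "c \<in> {c \<in> face_chains new n. contraction v c = (\<lambda>_. 0)}"
    using c face_chains_mono[OF induced_mono[of A "insert v A"]] by (auto simp: contraction_def)
qed (auto intro: face_chains_contraction_zero)

lemma chain_dim_step:
  fixes F :: "'f::field itself"
  shows "chain_dim F new (Suc n) = chain_dim F lk n + chain_dim F old (Suc n)"
proof -
  let ?C = "face_chains new (Suc n) :: ('v list \<Rightarrow> 'f) set"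
  have "subdim (contraction v ` ?C) + subdim {c \<in> ?C. contraction v c = (\<lambda>_. 0)} = subdim ?C"
    by (rule rank_nullity_image[OF fin_subspace_face_chains[OF simplicial_new]]) (simp_all add: contraction_linear)
  then show ?thesis by (simp add: chain_dim_def contraction_image contraction_kernel)
qed

text \<open>The contraction anticommutes with the boundary and maps chains onto chains, so it maps
  boundaries onto boundaries.\<close>

lemma contraction_aug_boundaries:
  "contraction v ` aug_boundaries new (Suc n) = (aug_boundaries lk n :: ('v list \<Rightarrow> 'f::field) set)"
proof -
  let ?V = "vertices new"
  have fV: "finite ?V" by (rule finite_vertices[OF simplicial_new])
  have "vertices lk \<subseteq> ?V" 
    using vertex_of_face[OF simplicial_new] by (fastforce simp: vertices_def link_def)
  then have lk: "aug_boundaries lk n = aug_boundary ?V ` (face_chains lk (Suc n) :: ('v list \<Rightarrow> 'f) set)"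
    by (rule aug_boundaries_eq[OF simplicial_lk fV])
  have "contraction v ` aug_boundaries new (Suc n)
      = (\<lambda>c vs. - c vs) ` aug_boundary ?V ` contraction v ` (face_chains new (Suc (Suc n)) :: ('v list \<Rightarrow> 'f) set)"
    unfolding aug_boundaries_def image_image
    by (rule image_cong[OF refl]) (rule contraction_aug_boundary)
  also have "\<dots> = (\<lambda>c vs. - c vs) ` aug_boundaries lk n"
    unfolding contraction_image lk ..
  also have "\<dots> = aug_boundaries lk n"
  proof -
    have neg: "(\<lambda>vs. - c vs) \<in> aug_boundaries lk n" if "c \<in> aug_boundaries lk n" for c :: "'v list \<Rightarrow> 'f"
      using fun_subspace_smult[OF fun_subspace_aug_boundaries that, of "- 1"] by simp
    show ?thesis
    proof (intro equalityI subsetI)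
      fix c :: "'v list \<Rightarrow> 'f" assume "c \<in> aug_boundaries lk n"
      then show "c \<in> (\<lambda>c vs. - c vs) ` aug_boundaries lk n"
        using neg by (intro image_eqI[of _ _ "\<lambda>vs. - c vs"]) auto
    qed (use neg in auto)
  qed
  finally show ?thesis .
qed

text \<open>Boundaries of the larger complex that are chains of the smaller one need not be boundaries
  there; they represent the homology classes that die when \<open>v\<close> is added.\<close>

lemma boundary_rank_step:
  fixes F :: "'f::field itself"
  shows "boundary_rank F new (Suc n) = boundary_rank F lk n +
     subdim (aug_boundaries new (Suc n) \<inter> face_chains old (Suc n) :: ('v list \<Rightarrow> 'f) set)"
proof -
  let ?B = "aug_boundaries new (Suc n) :: ('v list \<Rightarrow> 'f) set"
  have "subdim (contraction v ` ?B) + subdim {c \<in> ?B. contraction v c = (\<lambda>_. 0)} = subdim ?B"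
    by (rule rank_nullity_image[OF fin_subspace_aug_boundaries[OF simplicial_new]]) (simp_all add: contraction_linear)
  moreover have "{c \<in> ?B. contraction v c = (\<lambda>_. 0)} = ?B \<inter> face_chains old (Suc n)"
    using contraction_kernel[of "Suc n"] aug_boundaries_subset[OF simplicial_new, of "Suc n"] by blast
  ultimately show ?thesis by (simp add: boundary_rank_def contraction_aug_boundaries)
qed

end

definition empty_face_chain :: "'v list \<Rightarrow> 'f::field" where
  "empty_face_chain = (\<lambda>vs. if vs = [] then 1 else 0)"

lemma face_chains_0:
  fixes X :: "'v set set"
  assumes X: "simplicial_complex X"
  shows "face_chains X 0 = {(\<lambda>vs. a * empty_face_chain vs :: 'f::field) | a. True}"
proof (intro equalityI subsetI)
  fix c :: "'v list \<Rightarrow> 'f" assume c: "c \<in> face_chains X 0"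
  have "c vs = 0" if "vs \<noteq> []" for vs using face_chainsD(1)[OF c, of vs] that by auto
  then have "c = (\<lambda>vs. c [] * empty_face_chain vs)" by (auto simp: empty_face_chain_def)
  then show "c \<in> {(\<lambda>vs. a * empty_face_chain vs) | a. True}" by blast
next
  fix c :: "'v list \<Rightarrow> 'f" assume "c \<in> {(\<lambda>vs. a * empty_face_chain vs) | a. True}"
  then obtain a where "c = (\<lambda>vs. a * empty_face_chain vs)" by blast
  then have c: "c = (\<lambda>vs. if vs = [] then a else 0)" by (auto simp: empty_face_chain_def)
  have e: "permute_list p vs = [] \<longleftrightarrow> vs = []" for p and vs :: "'v list"
    by (metis length_0_conv length_permute_list)
  have "{} \<in> X" using X by (simp add: simplicial_complex_def)
  then show "c \<in> face_chains X 0" by (simp add: c face_chains_def e)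
qed

lemma chain_dim_0:
  fixes F :: "'f::field itself" and X :: "'v set set"
  assumes X: "simplicial_complex X"
  shows "chain_dim F X 0 = 1"
proof -
  let ?W = "face_chains X 0 :: ('v list \<Rightarrow> 'f) set"
  have sub: "fun_subspace ?W" by (rule fun_subspace_face_chains)
  interpret W: vectorspace class_ring "fun_space\<lparr>carrier := ?W\<rparr>" by (rule vectorspace_subspace[OF sub])
  have "(\<lambda>vs. 1 * empty_face_chain vs) \<in> ?W" unfolding face_chains_0[OF X] by blast
  then have e: "empty_face_chain \<in> ?W" by simp
  have sm: "submodule class_ring ?W fun_space" using sub by (simp add: subspace_def)
  have sp: "fun_subspace (FS.span {empty_face_chain :: 'v list \<Rightarrow> 'f})" by (rule FS.span_is_subspace) simp
  have "empty_face_chain \<in> FS.span {empty_face_chain :: 'v list \<Rightarrow> 'f}"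
    using FS.in_own_span[of "{empty_face_chain}"] by simp
  then have "?W \<subseteq> FS.span {empty_face_chain}"
    unfolding face_chains_0[OF X] using fun_subspace_smult[OF sp] by auto
  moreover have "FS.span {empty_face_chain} \<subseteq> ?W" by (rule FS.span_is_subset) (use e sm in auto)
  moreover have "W.span {empty_face_chain} = FS.span {empty_face_chain}"
    by (rule FS.span_li_not_depend(1)) (use e sm in auto)
  ultimately have "W.span {empty_face_chain} = ?W" by simp
  moreover have "(empty_face_chain :: 'v list \<Rightarrow> 'f) \<noteq> (\<lambda>_. 0)"
    by (auto simp: empty_face_chain_def fun_eq_iff intro!: exI[of _ "[]"])
  ultimately have "W.dim = 1" using e by (intro W.dim1I[of empty_face_chain]) (simp_all)
  then show ?thesis by (simp add: chain_dim_def)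
qed

text \<open>The augmentation is onto as soon as there is a vertex. A complex with a single vertex suffices
  as a witness, and there the augmentation is the contraction by that vertex.\<close>

lemma boundary_rank_0:
  fixes F :: "'f::field itself" and X :: "'v set set"
  assumes X: "simplicial_complex X"
  shows "boundary_rank F X 0 = (if vertices X = {} then 0 else 1)"
proof (cases "vertices X = {}")
  case True
  have "aug_boundary {} = (\<lambda>(c :: 'v list \<Rightarrow> 'f) vs. 0)" by (simp add: aug_boundary_def fun_eq_iff)
  moreover have "(face_chains X (Suc 0) :: ('v list \<Rightarrow> 'f) set) \<noteq> {}"
    using fun_subspace_zero[OF fun_subspace_face_chains[of X "Suc 0"]] by blast
  ultimately have "aug_boundaries X 0 = {\<lambda>_ :: 'v list. 0 :: 'f}"
    unfolding aug_boundaries_def True by (simp add: image_constant_conv)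
  then show ?thesis using True subdim_zero by (simp add: boundary_rank_def)
next
  case False
  then obtain v where v: "{v} \<in> X" by (auto simp: vertices_def)
  \<comment> \<open>the subcomplex of a single vertex, whose augmentation is the contraction by \<open>v\<close>\<close>
  define Y where "Y = {{}, {v}}"
  have Y: "simplicial_complex Y" "vertices Y = {v}" "Y \<subseteq> X"
    using v X by (auto simp: Y_def simplicial_complex_def vertices_def)
  have "link v Y = {{}}" by (auto simp: Y_def link_def)
  then have "simplicial_complex (link v Y)" by (simp add: simplicial_complex_def)
  have "(\<lambda>vs. 1 * empty_face_chain vs) \<in> (face_chains (link v Y) 0 :: ('v list \<Rightarrow> 'f) set)"
    unfolding face_chains_0[OF \<open>simplicial_complex (link v Y)\<close>] by blast
  then obtain c :: "'v list \<Rightarrow> 'f" where c: "c \<in> face_chains Y (Suc 0)" "contraction v c = empty_face_chain"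
    by (auto dest!: contraction_surj)
  have "aug_boundary (vertices Y) c = empty_face_chain"
    using c(2) by (simp add: Y(2) aug_boundary_def contraction_def)
  then have "empty_face_chain \<in> (aug_boundaries Y 0 :: ('v list \<Rightarrow> 'f) set)"
    unfolding aug_boundaries_def using c(1) by (metis image_eqI)
  then have e: "empty_face_chain \<in> (aug_boundaries X 0 :: ('v list \<Rightarrow> 'f) set)"
    using aug_boundaries_mono[OF Y(1) X Y(3)] by blast
  have "face_chains X 0 \<subseteq> (aug_boundaries X 0 :: ('v list \<Rightarrow> 'f) set)"
    unfolding face_chains_0[OF X] using fun_subspace_smult[OF fun_subspace_aug_boundaries e] by auto
  then have "aug_boundaries X 0 = (face_chains X 0 :: ('v list \<Rightarrow> 'f) set)"
    using aug_boundaries_subset[OF X] by blast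
  then show ?thesis using False chain_dim_0[OF X, of F] by (simp add: boundary_rank_def chain_dim_def)
qed

text \<open>The Betti number of \<open>induced X (insert v A)\<close> relative to \<open>induced X A\<close>, where \<open>L\<close> is the link
  of \<open>v\<close> in the larger complex. It is the reduced Betti number of \<open>L\<close> one degree lower. The correction
  for \<open>vertices L = {}\<close> is due to the convention that \<open>reduced_betti\<close> is \<open>- 1\<close> in degree zero for the
  empty complex, whose reduced homology sits in degree \<open>- 1\<close> instead.\<close>

definition relative_betti :: "'f::field itself \<Rightarrow> 'v set set \<Rightarrow> nat \<Rightarrow> int" where
  "relative_betti F L j = (if j = 0 then if vertices L = {} then 1 else 0
     else reduced_betti F L (j - 1) + (if j = 1 \<and> vertices L = {} then 1 else 0))"

lemma relative_betti_eq:
  assumes L: "simplicial_complex L"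
  shows "relative_betti F L j = int (chain_dim F L j) - int (boundary_rank F L j)
    - (if j = 0 then 0 else int (boundary_rank F L (j - 1)))"
proof (cases j)
  case 0
  then show ?thesis by (simp add: relative_betti_def chain_dim_0[OF L] boundary_rank_0[OF L])
next
  case (Suc k)
  show ?thesis
    using betti_formula[OF L, of F k] boundary_rank_0[OF L, of F] Suc
    by (cases k) (auto simp: relative_betti_def reduced_betti_def)
qed

text \<open>The dimension of the kernel of \<open>H\<^sub>i(X[A]) \<rightarrow> H\<^sub>i(X[A \<union> {v}])\<close>. Boundaries are cycles, so the
  cycles of \<open>X[A]\<close> that bound in \<open>X[A \<union> {v}]\<close> are just the chains of \<open>X[A]\<close> that do.\<close>

definition killed_dim :: "'f::field itself \<Rightarrow> 'v set set \<Rightarrow> 'v set \<Rightarrow> 'v \<Rightarrow> nat \<Rightarrow> nat" where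
  "killed_dim F X A v i =
     subdim (aug_boundaries (induced X (insert v A)) (Suc i) \<inter> face_chains (induced X A) (Suc i)
       :: ('v list \<Rightarrow> 'f) set) - boundary_rank F (induced X A) (Suc i)"

lemma killed_space:
  fixes X :: "'v set set" and A v n
  assumes X: "simplicial_complex X"
  defines "K \<equiv> aug_boundaries (induced X (insert v A)) n \<inter> face_chains (induced X A) n :: ('v list \<Rightarrow> 'f::field) set"
  shows "aug_boundaries (induced X A) n \<subseteq> K" "fin_subspace K"
proof -
  note s = simplicial_complex_induced[OF X]
  show "aug_boundaries (induced X A) n \<subseteq> K"
    unfolding K_def
    using aug_boundaries_subset[OF s] aug_boundaries_mono[OF s s induced_mono[of A "insert v A"]] by blast
  have "fun_subspace K"
    unfolding K_def by (rule fun_subspace_Int[OF fun_subspace_aug_boundaries fun_subspace_face_chains])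
  then show "fin_subspace K"
    by (rule fin_subspace_mono[OF fin_subspace_face_chains[OF s]]) (auto simp: K_def)
qed

lemma killed_dim_eq_0_iff:
  fixes F :: "'f::field itself"
  assumes X: "simplicial_complex X"
  shows "killed_dim F X A v i = 0 \<longleftrightarrow>
    aug_boundaries (induced X (insert v A)) (Suc i) \<inter> face_chains (induced X A) (Suc i)
      \<subseteq> (aug_boundaries (induced X A) (Suc i) :: ('v list \<Rightarrow> 'f) set)"
    (is "_ \<longleftrightarrow> ?K \<subseteq> ?B")
proof -
  have k: "?B \<subseteq> ?K" "fin_subspace ?K" using killed_space[OF X] by blast+
  have B: "fun_subspace ?B" by (rule fun_subspace_aug_boundaries)
  have "killed_dim F X A v i = subdim ?K - subdim ?B" by (simp add: killed_dim_def boundary_rank_def)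
  moreover have "subdim ?B \<le> subdim ?K" by (rule subdim_mono[OF k(2) B k(1)])
  moreover have "?B = ?K" if "subdim ?B = subdim ?K" using subdim_eq_imp_eq[OF k(2) B k(1) that] .
  ultimately show ?thesis using k(1) by (metis diff_is_0_eq diff_self_eq_0 le_antisym order_refl subset_antisym)
qed

text \<open>What the long exact homology sequence of the pair says about dimensions. It follows from the
  formulas for chain dimensions and ranks by adding up.\<close>

lemma betti_step:
  fixes F :: "'f::field itself" and X :: "'v set set"
  assumes X: "simplicial_complex X" and v: "v \<in> vertices X" and vA: "v \<notin> A"
  shows "int (betti F (induced X (insert v A)) j) - int (betti F (induced X A) j)
      + int (killed_dim F X A v j) + (if j = 0 then 0 else int (killed_dim F X A v (j - 1)))
    = relative_betti F (link v (induced X (insert v A))) j"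
proof -
  let ?old = "induced X A" and ?new = "induced X (insert v A)"
  let ?L = "link v ?new"
  have rank: "boundary_rank F ?new (Suc n) = boundary_rank F ?L n + killed_dim F X A v n + boundary_rank F ?old (Suc n)" for n
  proof -
    have "boundary_rank F ?old (Suc n) \<le>
        subdim (aug_boundaries ?new (Suc n) \<inter> face_chains ?old (Suc n) :: ('v list \<Rightarrow> 'f) set)"
      unfolding boundary_rank_def
      by (rule subdim_mono[OF killed_space(2)[OF X] fun_subspace_aug_boundaries killed_space(1)[OF X]])
    then show ?thesis using boundary_rank_step[OF X v vA, of F n] by (simp add: killed_dim_def)
  qed
  have "relative_betti F ?L j = int (chain_dim F ?L j) - int (boundary_rank F ?L j)
    - (if j = 0 then 0 else int (boundary_rank F ?L (j - 1)))"
    by (rule relative_betti_eq[OF simplicial_lk[OF X v vA]])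
  then show ?thesis
    using betti_formula[OF simplicial_new[OF X v vA], of F j] betti_formula[OF simplicial_old[OF X v vA], of F j]
      chain_dim_step[OF X v vA, of F j] rank[of j] rank[of "j - 1"]
    by (cases j) auto
qed

lemma link_induced:
  assumes X: "simplicial_complex X" and v: "v \<in> vertices X" and vA: "v \<notin> A"
  shows "link v (induced X (insert v A)) = induced (link v X) (A \<inter> vertices (link v X))"
proof -
  have "\<alpha> \<subseteq> vertices (link v X)" if "\<alpha> \<in> link v X" for \<alpha>
    using vertex_of_face[OF simplicial_complex_link[OF X v] that] by blast
  then show ?thesis using vA by (auto simp: link_def induced_def)
qed

section \<open>Averages over the orders of a set\<close>

text \<open>The probability that, in a random order of a set with \<open>m + 1\<close> elements, the elements that
  precede a given one form a given set of size \<open>a\<close>.\<close>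

definition prefix_weight :: "nat \<Rightarrow> nat \<Rightarrow> real" where
  "prefix_weight m a = fact a * fact (m - a) / fact (Suc m)"

lemma prefix_weight_pos: "prefix_weight m a > 0"
  by (simp add: prefix_weight_def)

lemma prefix_weight_binomial:
  assumes "a \<le> m"
  shows "prefix_weight m a = 1 / (real (m choose a) * (1 + real m))"
  using assms by (simp add: prefix_weight_def binomial_fact field_simps)

text \<open>One more element is put into the order: it comes either after the given one, or before it.\<close>

lemma prefix_weight_split:
  assumes "a \<le> m"
  shows "prefix_weight m a = prefix_weight (Suc m) a + prefix_weight (Suc m) (Suc a)"
proof -
  obtain d where m: "m = a + d" using assms le_Suc_ex by blast
  have "fact (Suc (Suc m)) = (real m + 2) * (fact (Suc m) :: real)" 
    by (simp add: algebra_simps)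
  moreover have "fact (Suc m) \<noteq> (0 :: real)" by simp
  ultimately show ?thesis
    unfolding prefix_weight_def m by (simp add: divide_simps Suc_diff_le del: fact_Suc) (simp add: algebra_simps)
qed

lemma sum_Pow_insert:
  assumes "finite M" "x \<notin> M"
  shows "(\<Sum>A\<in>Pow (insert x M). h A) = (\<Sum>A\<in>Pow M. h A + h (insert x A))"
proof -
  have "inj_on (insert x) (Pow M)" using assms(2) by (auto simp: inj_on_def)
  moreover have "Pow M \<inter> insert x ` Pow M = {}" using assms(2) by auto
  ultimately show ?thesis
    using assms(1) by (simp add: Pow_insert sum.union_disjoint sum.reindex sum.distrib)
qed

text \<open>A random order of a set induces a random order of each subset. Hence a function of those
  predecessors that lie in \<open>N\<close> may be averaged over the orders of \<open>N\<close> with one more element; the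
  proof removes the other elements one by one.\<close>

lemma sum_prefix_weight_restrict:
  assumes "finite N" "finite R" "N \<inter> R = {}"
  shows "(\<Sum>A\<in>Pow (N \<union> R). prefix_weight (card (N \<union> R)) (card A) * g (A \<inter> N))
    = (\<Sum>B\<in>Pow N. prefix_weight (card N) (card B) * g B)"
  using assms(2,3)
proof (induction R rule: finite_induct)
  case empty
  then show ?case by (auto intro!: sum.cong simp: Int_absorb2)
next
  case (insert x R)
  let ?M = "N \<union> R"
  have M: "finite ?M" "x \<notin> ?M" "x \<notin> N" using insert assms(1) by auto
  have "prefix_weight (card (insert x ?M)) (card A) * g (A \<inter> N)
      + prefix_weight (card (insert x ?M)) (card (insert x A)) * g (insert x A \<inter> N)
    = prefix_weight (card ?M) (card A) * g (A \<inter> N)" if "A \<in> Pow ?M" for A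
  proof -
    have A: "finite A" "x \<notin> A" "card A \<le> card ?M"
      using that M(2) finite_subset[OF _ M(1), of A] card_mono[OF M(1), of A] by auto
    have "insert x A \<inter> N = A \<inter> N" using M(3) by auto
    then show ?thesis using prefix_weight_split[OF A(3)] A M by (simp add: distrib_right)
  qed
  then have "(\<Sum>A\<in>Pow (insert x ?M). prefix_weight (card (insert x ?M)) (card A) * g (A \<inter> N))
      = (\<Sum>A\<in>Pow ?M. prefix_weight (card ?M) (card A) * g (A \<inter> N))"
    unfolding sum_Pow_insert[OF M(1,2)] by (rule sum.cong[OF refl])
  then show ?case using insert by simp
qed

text \<open>Along any order of \<open>V\<close> the increments of \<open>f\<close> over the initial segments add up to
  \<open>f V - f {}\<close>, and so does their average over all orders. The proof compares coefficients: a set \<open>B\<close>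
  is an initial segment with probability \<open>q (card B)\<close>; it occurs as \<open>insert v A\<close> unless it is empty
  and as \<open>A\<close> unless it is \<open>V\<close>.\<close>

lemma sum_prefix_weight_telescope:
  fixes f :: "'v set \<Rightarrow> real"
  assumes V: "finite V"
  shows "(\<Sum>v\<in>V. \<Sum>A\<in>Pow (V - {v}). prefix_weight (card V - 1) (card A) * (f (insert v A) - f A))
    = f V - f {}"
proof (cases "V = {}")
  case False
  define n where "n = card V"
  then have n: "n > 0" using False V by (simp add: card_gt_0_iff)
  let ?w = "prefix_weight (n - 1)"
  \<comment> \<open>the probability that a given set of size \<open>b\<close> is an initial segment of a random order of \<open>V\<close>\<close>
  define q where "q b = fact b * fact (n - b) / (fact n :: real)" for b
  have up: "real b * ?w (b - 1) = q b - (if b = 0 then 1 else 0)" if "b \<le> n" for b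
    using n by (cases b) (simp_all add: prefix_weight_def q_def)
  have down: "real (n - b) * ?w b = q b - (if b = n then 1 else 0)" if "b \<le> n" for b
  proof (cases "b = n")
    case False
    then have "fact (n - b) = real (n - b) * fact (n - 1 - b)"
      using that by (subst fact_reduce) auto
    then show ?thesis using n False by (simp add: prefix_weight_def q_def)
  qed (simp add: q_def)
  have 1: "(\<Sum>v\<in>V. \<Sum>A\<in>Pow (V - {v}). ?w (card A) * f (insert v A))
      = (\<Sum>B\<in>Pow V. real (card B) * ?w (card B - 1) * f B)"
  proof -
    have "(\<Sum>A\<in>Pow (V - {v}). ?w (card A) * f (insert v A))
        = (\<Sum>B\<in>{B \<in> Pow V. v \<in> B}. ?w (card B - 1) * f B)" if "v \<in> V" for v
      by (rule sum.reindex_bij_witness[of _ "\<lambda>B. B - {v}" "insert v"])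
        (use that finite_subset[OF _ V] in \<open>auto simp: subset_Diff_insert insert_absorb\<close>)
    then have "(\<Sum>v\<in>V. \<Sum>A\<in>Pow (V - {v}). ?w (card A) * f (insert v A))
        = (\<Sum>v\<in>V. \<Sum>B\<in>{B \<in> Pow V. v \<in> B}. ?w (card B - 1) * f B)" by simp
    also have "\<dots> = (\<Sum>B\<in>Pow V. \<Sum>v\<in>{v \<in> V. v \<in> B}. ?w (card B - 1) * f B)"
      by (rule sum.swap_restrict) (use V in auto)
    also have "\<dots> = (\<Sum>B\<in>Pow V. real (card B) * ?w (card B - 1) * f B)"
    proof (rule sum.cong[OF refl])
      fix B assume "B \<in> Pow V"
      then have "{v \<in> V. v \<in> B} = B" by auto
      then show "(\<Sum>v\<in>{v \<in> V. v \<in> B}. ?w (card B - 1) * f B) = real (card B) * ?w (card B - 1) * f B"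
        by simp
    qed
    finally show ?thesis .
  qed
  have 2: "(\<Sum>v\<in>V. \<Sum>A\<in>Pow (V - {v}). ?w (card A) * f A)
      = (\<Sum>B\<in>Pow V. real (n - card B) * ?w (card B) * f B)"
  proof -
    have "(\<Sum>v\<in>V. \<Sum>A\<in>Pow (V - {v}). ?w (card A) * f A)
        = (\<Sum>v\<in>V. \<Sum>B\<in>{B \<in> Pow V. v \<notin> B}. ?w (card B) * f B)"
      by (intro sum.cong refl) auto
    also have "\<dots> = (\<Sum>B\<in>Pow V. \<Sum>v\<in>{v \<in> V. v \<notin> B}. ?w (card B) * f B)"
      by (rule sum.swap_restrict) (use V in auto)
    also have "\<dots> = (\<Sum>B\<in>Pow V. real (n - card B) * ?w (card B) * f B)"
    proof (rule sum.cong[OF refl])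
      fix B assume "B \<in> Pow V"
      then have "{v \<in> V. v \<notin> B} = V - B" "card (V - B) = n - card B"
        using V by (auto simp: n_def card_Diff_subset finite_subset)
      then show "(\<Sum>v\<in>{v \<in> V. v \<notin> B}. ?w (card B) * f B) = real (n - card B) * ?w (card B) * f B"
        by simp
    qed
    finally show ?thesis .
  qed
  have "(\<Sum>v\<in>V. \<Sum>A\<in>Pow (V - {v}). ?w (card A) * (f (insert v A) - f A))
      = (\<Sum>B\<in>Pow V. (real (card B) * ?w (card B - 1) - real (n - card B) * ?w (card B)) * f B)"
    by (simp only: right_diff_distrib left_diff_distrib sum_subtractf 1 2)
  also have "\<dots> = (\<Sum>B\<in>Pow V. (if B = V then f B else 0) - (if B = {} then f B else 0))"
  proof (rule sum.cong[OF refl])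
    fix B assume B: "B \<in> Pow V"
    then have le: "card B \<le> n" using V card_mono by (auto simp: n_def)
    have "card B = n \<longleftrightarrow> B = V" using B V card_subset_eq by (auto simp: n_def)
    moreover have "card B = 0 \<longleftrightarrow> B = {}" using B finite_subset[OF _ V, of B] by simp
    ultimately show "(real (card B) * ?w (card B - 1) - real (n - card B) * ?w (card B)) * f B
      = (if B = V then f B else 0) - (if B = {} then f B else 0)"
      unfolding up[OF le] down[OF le] by auto
  qed
  also have "\<dots> = f V - f {}"
    using V by (simp add: sum_subtractf)
  finally show ?thesis by (simp add: n_def)
qed simp

section \<open>The mu-vector and the Betti numbers\<close>

text \<open>The factor \<open>1 / (1 + f0 L)\<close> and the binomial coefficient of \<open>sigma\<close> multiply to the weight
  of a set of predecessors, and the Kronecker symbol is the contribution of the empty set.\<close>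

lemma relative_betti_mu_term:
  fixes F :: "'f::field itself" and L :: "'v set set"
  assumes L: "simplicial_complex L"
  shows "(\<Sum>B\<in>Pow (vertices L). prefix_weight (f0 L) (card B) * real_of_int (relative_betti F (induced L B) j))
    = (if j = 0 then 1 else (if j = 1 then 1 else 0) + sigma F L (j - 1)) / (1 + real (f0 L))"
proof -
  let ?N = "vertices L" and ?m = "f0 L"
  have fin: "finite ?N" by (rule finite_vertices[OF L])
  have le: "card B \<le> ?m" if "B \<in> Pow ?N" for B
    using that card_mono[OF fin] by (auto simp: f0_def)
  have vert: "vertices (induced L B) = {} \<longleftrightarrow> B = {}" if "B \<in> Pow ?N" for B
    using that by (auto simp: vertices_def induced_def)
  have w0: "prefix_weight ?m 0 = 1 / (1 + real ?m)" by (simp add: prefix_weight_binomial)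
  have empty: "(\<Sum>B\<in>Pow ?N. prefix_weight ?m (card B) * (if B = {} then 1 else 0)) = 1 / (1 + real ?m)"
  proof -
    have "(\<Sum>B\<in>Pow ?N. prefix_weight ?m (card B) * (if B = {} then 1 else 0))
        = (\<Sum>B\<in>Pow ?N. if B = {} then prefix_weight ?m 0 else 0)"
      by (rule sum.cong) auto
    then show ?thesis using fin w0 by simp
  qed
  show ?thesis
  proof (cases "j = 0")
    case True
    have "(\<Sum>B\<in>Pow ?N. prefix_weight ?m (card B) * real_of_int (relative_betti F (induced L B) j))
        = (\<Sum>B\<in>Pow ?N. prefix_weight ?m (card B) * (if B = {} then 1 else 0))"
      by (rule sum.cong[OF refl]) (simp add: relative_betti_def True vert)
    then show ?thesis using empty True by simp
  next
    case False
    have "(\<Sum>B\<in>Pow ?N. prefix_weight ?m (card B) * real_of_int (relative_betti F (induced L B) j))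
        = (\<Sum>B\<in>Pow ?N. real_of_int (reduced_betti F (induced L B) (j - 1)) / real (?m choose card B) / (1 + real ?m)
            + (if j = 1 then 1 else 0) * (prefix_weight ?m (card B) * (if B = {} then 1 else 0)))"
    proof (rule sum.cong[OF refl])
      fix B assume B: "B \<in> Pow ?N"
      have "prefix_weight ?m (card B) * real_of_int (reduced_betti F (induced L B) (j - 1))
          = real_of_int (reduced_betti F (induced L B) (j - 1)) / real (?m choose card B) / (1 + real ?m)"
        by (simp add: prefix_weight_binomial[OF le[OF B]])
      then show "prefix_weight ?m (card B) * real_of_int (relative_betti F (induced L B) j)
        = real_of_int (reduced_betti F (induced L B) (j - 1)) / real (?m choose card B) / (1 + real ?m)
            + (if j = 1 then 1 else 0) * (prefix_weight ?m (card B) * (if B = {} then 1 else 0))"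
        using False vert[OF B] by (simp add: relative_betti_def distrib_left)
    qed
    also have "\<dots> = sigma F L (j - 1) / (1 + real ?m) + (if j = 1 then 1 else 0) * (1 / (1 + real ?m))"
      by (simp only: sum.distrib sum_divide_distrib[symmetric] sum_distrib_left[symmetric] empty sigma_def)
    finally show ?thesis using False by (simp add: add_divide_distrib)
  qed
qed

text \<open>Adding \<open>v\<close> to its predecessors \<open>A\<close> attaches a cone over the part of the link of \<open>v\<close> spanned by
  \<open>A\<close>, so only the predecessors that are neighbours of \<open>v\<close> matter.\<close>

lemma mu_eq_weighted_relative_betti:
  fixes F :: "'f::field itself" and X :: "'v set set"
  assumes X: "simplicial_complex X"
  shows "mu F X j = (\<Sum>v\<in>vertices X. \<Sum>A\<in>Pow (vertices X - {v}).
    prefix_weight (f0 X - 1) (card A) * real_of_int (relative_betti F (link v (induced X (insert v A))) j))"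
proof -
  have "(\<Sum>A\<in>Pow (vertices X - {v}). prefix_weight (f0 X - 1) (card A)
        * real_of_int (relative_betti F (link v (induced X (insert v A))) j))
      = (if j = 0 then 1 else (if j = 1 then 1 else 0) + sigma F (link v X) (j - 1)) / (1 + real (f0 (link v X)))"
    if v: "v \<in> vertices X" for v
  proof -
    let ?L = "link v X"
    let ?N = "vertices ?L"
    \<comment> \<open>\<open>?N\<close> are the neighbours of \<open>v\<close>, \<open>?R\<close> the other vertices\<close>
    let ?R = "vertices X - {v} - ?N"
    have L: "simplicial_complex ?L" by (rule simplicial_complex_link[OF X v])
    have "?N \<subseteq> vertices X - {v}"
      using vertex_of_face[OF X] by (auto simp: vertices_def link_def)
    then have NR: "?N \<union> ?R = vertices X - {v}" by blast
    have fin: "finite ?N" "finite ?R" using finite_vertices[OF L] finite_vertices[OF X] by auto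
    have card: "card (?N \<union> ?R) = f0 X - 1"
      using v finite_vertices[OF X] unfolding NR f0_def by simp
    have "(\<Sum>A\<in>Pow (vertices X - {v}). prefix_weight (f0 X - 1) (card A)
          * real_of_int (relative_betti F (link v (induced X (insert v A))) j))
        = (\<Sum>A\<in>Pow (?N \<union> ?R). prefix_weight (card (?N \<union> ?R)) (card A)
          * real_of_int (relative_betti F (induced ?L (A \<inter> ?N)) j))"
      unfolding card unfolding NR
    proof (rule sum.cong[OF refl])
      fix A assume "A \<in> Pow (vertices X - {v})"
      then have "v \<notin> A" by auto
      then show "prefix_weight (f0 X - 1) (card A) * real_of_int (relative_betti F (link v (induced X (insert v A))) j)
        = prefix_weight (f0 X - 1) (card A) * real_of_int (relative_betti F (induced ?L (A \<inter> ?N)) j)"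
        by (simp add: link_induced[OF X v])
    qed
    also have "\<dots> = (\<Sum>B\<in>Pow ?N. prefix_weight (f0 ?L) (card B) * real_of_int (relative_betti F (induced ?L B) j))"
      unfolding f0_def
      by (rule sum_prefix_weight_restrict[OF fin, where g = "\<lambda>B. real_of_int (relative_betti F (induced ?L B) j)"]) blast
    also note relative_betti_mu_term[OF L]
    finally show ?thesis .
  qed
  then show ?thesis by (simp add: mu_def)
qed

lemma face_chains_zero:
  assumes "\<And>\<alpha>. \<alpha> \<in> X \<Longrightarrow> card \<alpha> < n" 
  shows "face_chains X n = {\<lambda>_. 0}"
proof -
  have "c vs = 0" if c: "c \<in> face_chains X n" for c vs
    using face_chainsD(1-3)[OF c, of vs] assms[of "set vs"] distinct_card[of vs] by force
  then show ?thesis using fun_subspace_zero[OF fun_subspace_face_chains[of X n]] by (auto simp: fun_eq_iff)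
qed

lemma induced_vertices: "simplicial_complex X \<Longrightarrow> induced X (vertices X) = X"
  using vertex_of_face by (fastforce simp: induced_def)

lemma induced_Int_vertices: "simplicial_complex X \<Longrightarrow> induced X (A \<inter> vertices X) = induced X A"
  using vertex_of_face by (fastforce simp: induced_def)

lemma betti_induced_empty:
  assumes X: "simplicial_complex X"
  shows "betti F (induced X {}) j = 0"
proof -
  have "card \<alpha> < Suc j" if "\<alpha> \<in> induced X {}" for \<alpha> using that by (auto simp: induced_def)
  then have "chain_dim F (induced X {}) (Suc j) = 0"
    by (simp add: chain_dim_def face_chains_zero subdim_zero)
  then show ?thesis using betti_formula[OF simplicial_complex_induced[OF X], of F "{}" j] by simp
qed

text \<open>The Morse relations, averaged over all orders of the vertices.\<close>

lemma mu_eq_betti_plus_killed: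
  fixes F :: "'f::field itself" and X :: "'v set set"
  assumes X: "simplicial_complex X"
  shows "mu F X j = real (betti F X j) + (\<Sum>v\<in>vertices X. \<Sum>A\<in>Pow (vertices X - {v}).
    prefix_weight (f0 X - 1) (card A) * real (killed_dim F X A v j + (if j = 0 then 0 else killed_dim F X A v (j - 1))))"
proof -
  let ?V = "vertices X"
  let ?b = "\<lambda>A. real (betti F (induced X A) j)"
  let ?k = "\<lambda>v A. real (killed_dim F X A v j + (if j = 0 then 0 else killed_dim F X A v (j - 1)))"
  let ?w = "\<lambda>A :: 'v set. prefix_weight (f0 X - 1) (card A)"
  have "?w A * real_of_int (relative_betti F (link v (induced X (insert v A))) j)
      = ?w A * (?b (insert v A) - ?b A) + ?w A * ?k v A"
    if "v \<in> ?V" "A \<in> Pow (?V - {v})" for v A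
  proof -
    have "v \<notin> A" using that by auto
    have "real_of_int (relative_betti F (link v (induced X (insert v A))) j) = (?b (insert v A) - ?b A) + ?k v A"
      unfolding betti_step[OF X that(1) \<open>v \<notin> A\<close>, symmetric] by simp
    then show ?thesis by (simp add: distrib_left)
  qed
  then have "mu F X j = (\<Sum>v\<in>?V. \<Sum>A\<in>Pow (?V - {v}). ?w A * (?b (insert v A) - ?b A) + ?w A * ?k v A)"
    unfolding mu_eq_weighted_relative_betti[OF X] by (intro sum.cong refl)
  also have "\<dots> = (\<Sum>v\<in>?V. \<Sum>A\<in>Pow (?V - {v}). ?w A * (?b (insert v A) - ?b A))
      + (\<Sum>v\<in>?V. \<Sum>A\<in>Pow (?V - {v}). ?w A * ?k v A)"
    by (simp only: sum.distrib)
  also have "(\<Sum>v\<in>?V. \<Sum>A\<in>Pow (?V - {v}). ?w A * (?b (insert v A) - ?b A)) = ?b ?V - ?b {}"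
    unfolding f0_def by (rule sum_prefix_weight_telescope[OF finite_vertices[OF X], of ?b])
  also have "\<dots> = real (betti F X j)"
    by (simp add: induced_vertices[OF X] betti_induced_empty[OF X])
  finally show ?thesis .
qed

lemma mu_eq_betti_iff:
  fixes F :: "'f::field itself" and X :: "'v set set"
  assumes X: "simplicial_complex X"
  shows "mu F X j = real (betti F X j) \<longleftrightarrow> (\<forall>v\<in>vertices X. \<forall>A\<subseteq>vertices X - {v}.
    killed_dim F X A v j = 0 \<and> (j \<noteq> 0 \<longrightarrow> killed_dim F X A v (j - 1) = 0))"
proof -
  let ?k = "\<lambda>v A. killed_dim F X A v j + (if j = 0 then 0 else killed_dim F X A v (j - 1))"
  let ?t = "\<lambda>v A. prefix_weight (f0 X - 1) (card A) * real (?k v A)"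
  have V: "finite (vertices X)" by (rule finite_vertices[OF X])
  have pos: "?t v A \<ge> 0" for v A by (simp add: less_imp_le[OF prefix_weight_pos])
  have zero: "?t v A = 0 \<longleftrightarrow> ?k v A = 0" for v A
    using prefix_weight_pos[of "f0 X - 1" "card A"] by (simp only: mult_eq_0_iff of_nat_eq_0_iff) auto
  have "mu F X j = real (betti F X j) \<longleftrightarrow> (\<Sum>v\<in>vertices X. \<Sum>A\<in>Pow (vertices X - {v}). ?t v A) = 0"
    by (simp add: mu_eq_betti_plus_killed[OF X])
  also have "\<dots> \<longleftrightarrow> (\<forall>v\<in>vertices X. (\<Sum>A\<in>Pow (vertices X - {v}). ?t v A) = 0)"
    by (rule sum_nonneg_eq_0_iff[OF V]) (rule sum_nonneg, rule pos)
  also have "\<dots> \<longleftrightarrow> (\<forall>v\<in>vertices X. \<forall>A\<in>Pow (vertices X - {v}). ?t v A = 0)"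
    by (intro ball_cong refl sum_nonneg_eq_0_iff pos) (use V in simp)
  also have "\<dots> \<longleftrightarrow> (\<forall>v\<in>vertices X. \<forall>A\<in>Pow (vertices X - {v}). ?k v A = 0)"
    unfolding zero ..
  finally show ?thesis by auto
qed

section \<open>Tightness\<close>

text \<open>The map is well defined as \<open>B \<subseteq> B'\<close> and sends the class of \<open>z\<close> to the class of \<open>z\<close>.
  Injectivity is a statement about differences of members of \<open>Z\<close>, and these fill \<open>Z\<close>.\<close>

lemma inj_on_coset_map:
  fixes Z B B' :: "('b \<Rightarrow> 'f::field) set"
  assumes Z: "fun_subspace Z" and B: "fun_subspace B" and B': "fun_subspace B'" and BB': "B \<subseteq> B'"
  shows "inj_on (\<lambda>C. \<Union>z\<in>C. B' +>\<^bsub>fun_space\<^esub> z) (a_rcosets\<^bsub>fun_space\<lparr>carrier := Z\<rparr>\<^esub> B)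
    \<longleftrightarrow> Z \<inter> B' \<subseteq> B"
proof -
  let ?V = "fun_space\<lparr>carrier := Z\<rparr>"
  have B'eq: "B' +>\<^bsub>fun_space\<^esub> y = B' +>\<^bsub>fun_space\<^esub> z \<longleftrightarrow> (\<lambda>x. y x - z x) \<in> B'" for y z
    using coset_eq_iff[OF B', of UNIV y UNIV z] carrier_update_self[of "fun_space :: ('f, 'b \<Rightarrow> 'f) module"]
    by (simp only: fun_space_simps)
  have map: "(\<Union>y\<in>B +>\<^bsub>?V\<^esub> z. B' +>\<^bsub>fun_space\<^esub> y) = B' +>\<^bsub>fun_space\<^esub> z" for z
  proof -
    have "B' +>\<^bsub>fun_space\<^esub> y = B' +>\<^bsub>fun_space\<^esub> z" if "y \<in> B +>\<^bsub>?V\<^esub> z" for y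
      using that BB' by (auto simp: B'eq coset_mem[OF B])
    moreover have "z \<in> B +>\<^bsub>?V\<^esub> z" using fun_subspace_zero[OF B] by (simp add: coset_mem[OF B])
    ultimately show ?thesis by blast
  qed
  have cosets: "a_rcosets\<^bsub>?V\<^esub> B = (\<lambda>z. B +>\<^bsub>?V\<^esub> z) ` Z"
    by (auto simp: A_RCOSETS_def RCOSETS_def a_r_coset_def)
  have "inj_on (\<lambda>C. \<Union>z\<in>C. B' +>\<^bsub>fun_space\<^esub> z) (a_rcosets\<^bsub>?V\<^esub> B)
    \<longleftrightarrow> (\<forall>y\<in>Z. \<forall>z\<in>Z. (\<lambda>x. y x - z x) \<in> B' \<longrightarrow> (\<lambda>x. y x - z x) \<in> B)"
    unfolding inj_on_def cosets ball_simps map B'eq coset_eq_iff[OF B] ..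
  also have "\<dots> \<longleftrightarrow> Z \<inter> B' \<subseteq> B"
  proof
    assume *: "\<forall>y\<in>Z. \<forall>z\<in>Z. (\<lambda>x. y x - z x) \<in> B' \<longrightarrow> (\<lambda>x. y x - z x) \<in> B"
    show "Z \<inter> B' \<subseteq> B"
      using *[rule_format, OF _ fun_subspace_zero[OF Z]] by auto
  next
    assume "Z \<inter> B' \<subseteq> B"
    then show "\<forall>y\<in>Z. \<forall>z\<in>Z. (\<lambda>x. y x - z x) \<in> B' \<longrightarrow> (\<lambda>x. y x - z x) \<in> B"
      using fun_subspace_diff[OF Z] by blast
  qed
  finally show ?thesis .
qed

lemma inj_on_homology_iff:
  fixes X :: "'v set set"
  assumes X: "simplicial_complex X"
  shows "inj_on (inclusion_map X i) (carrier (homology (induced X A) i :: ('f::field, ('v list \<Rightarrow> 'f) set) module))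
    \<longleftrightarrow> aug_boundaries X (Suc i) \<inter> face_chains (induced X A) (Suc i)
      \<subseteq> (aug_boundaries (induced X A) (Suc i) :: ('v list \<Rightarrow> 'f) set)"
proof -
  let ?Y = "induced X A"
  let ?Z = "cycles ?Y i :: ('v list \<Rightarrow> 'f) set"
  have Y: "simplicial_complex ?Y" "?Y \<subseteq> X"
    using simplicial_complex_induced[OF X] by (auto simp: induced_def)
  have bd: "aug_boundaries ?Y (Suc i) \<subseteq> (aug_boundaries X (Suc i) :: ('v list \<Rightarrow> 'f) set)"
    by (rule aug_boundaries_mono[OF Y(1) X Y(2)])
  have "inj_on (inclusion_map X i) (carrier (homology ?Y i :: ('f, ('v list \<Rightarrow> 'f) set) module))
    \<longleftrightarrow> inj_on (\<lambda>C. \<Union>z\<in>C. aug_boundaries X (Suc i) +>\<^bsub>fun_space\<^esub> z)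
      (a_rcosets\<^bsub>fun_space\<lparr>carrier := ?Z\<rparr>\<^esub> (aug_boundaries ?Y (Suc i)))"
    unfolding inclusion_map_def homology_def quotient_space_def boundaries_eq by simp
  also have "\<dots> \<longleftrightarrow> ?Z \<inter> aug_boundaries X (Suc i) \<subseteq> aug_boundaries ?Y (Suc i)"
    by (rule inj_on_coset_map[OF fun_subspace_cycles fun_subspace_aug_boundaries fun_subspace_aug_boundaries bd])
  also have "?Z \<inter> aug_boundaries X (Suc i) = aug_boundaries X (Suc i) \<inter> face_chains ?Y (Suc i)"
  proof (intro equalityI subsetI)
    fix c :: "'v list \<Rightarrow> 'f"
    assume c: "c \<in> aug_boundaries X (Suc i) \<inter> face_chains ?Y (Suc i)"
    have "c \<in> ?Z"
    proof (cases i)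
      case 0
      then show ?thesis using c by (simp add: cycles_0)
    next
      case (Suc k)
      obtain e where e: "c = aug_boundary (vertices X) e" "e \<in> face_chains X (Suc (Suc i))"
        using c unfolding aug_boundaries_def by blast
      have "vertices ?Y \<subseteq> vertices X" using Y(2) by (auto simp: vertices_def)
      then have "aug_boundary (vertices ?Y) c = aug_boundary (vertices X) c"
        using aug_boundary_cong[OF Y(1) _ finite_vertices[OF X]] c by (metis IntD2)
      also have "\<dots> = (\<lambda>_. 0)"
        unfolding e(1) by (rule aug_boundary_aug_boundary[OF finite_vertices[OF X] e(2)])
      finally show ?thesis using c Suc by (simp add: cycles_Suc)
    qed
    then show "c \<in> ?Z \<inter> aug_boundaries X (Suc i)" using c by blast
  qed (use cycles_subset in blast)
  finally show ?thesis .
qed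

text \<open>The inclusion of \<open>induced X A\<close> into \<open>X\<close> is a composition of inclusions that add one vertex each,
  so it induces injections if all of these do. Conversely, a class that dies when one vertex is added
  is dead in \<open>X\<close>.\<close>

lemma tight_iff_nothing_killed:
  fixes X :: "'v set set" and F :: "'f::field itself"
  assumes X: "simplicial_complex X"
  shows "tight F X \<longleftrightarrow> connected_complex X \<and>
    (\<forall>v\<in>vertices X. \<forall>A\<subseteq>vertices X - {v}. \<forall>i. killed_dim F X A v i = 0)"
proof -
  let ?B = "\<lambda>A i. aug_boundaries (induced X A) (Suc i) :: ('v list \<Rightarrow> 'f) set"
  let ?BX = "\<lambda>i. aug_boundaries X (Suc i) :: ('v list \<Rightarrow> 'f) set"
  let ?C = "\<lambda>A i. face_chains (induced X A) (Suc i) :: ('v list \<Rightarrow> 'f) set"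
  note killed = killed_dim_eq_0_iff[OF X, of F]
  have "(\<forall>A i. ?BX i \<inter> ?C A i \<subseteq> ?B A i) \<longleftrightarrow>
    (\<forall>v\<in>vertices X. \<forall>A\<subseteq>vertices X - {v}. \<forall>i. killed_dim F X A v i = 0)"
  proof
    assume all: "\<forall>A i. ?BX i \<inter> ?C A i \<subseteq> ?B A i"
    have "?B A i \<subseteq> ?BX i" for A i
      by (rule aug_boundaries_mono[OF simplicial_complex_induced[OF X] X]) (auto simp: induced_def)
    then show "\<forall>v\<in>vertices X. \<forall>A\<subseteq>vertices X - {v}. \<forall>i. killed_dim F X A v i = 0"
      unfolding killed using all by blast
  next
    assume none: "\<forall>v\<in>vertices X. \<forall>A\<subseteq>vertices X - {v}. \<forall>i. killed_dim F X A v i = 0"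
    have fin: "finite (vertices X)" by (rule finite_vertices[OF X])
    have sub: "?BX i \<inter> ?C A i \<subseteq> ?B A i" if "A \<subseteq> vertices X" for A i
      using that
    proof (induction "card (vertices X - A)" arbitrary: A)
      case 0
      then have "A = vertices X" using fin by auto
      then show ?case by (simp add: induced_vertices[OF X])
    next
      case (Suc n)
      then have "vertices X - A \<noteq> {}" by (metis card.empty nat.distinct(1))
      then obtain v where v: "v \<in> vertices X" "v \<notin> A" by blast
      have "vertices X - insert v A = vertices X - A - {v}" by blast
      then have "n = card (vertices X - insert v A)"
        using Suc.hyps(2) v fin by simp
      then have IH: "?BX i \<inter> ?C (insert v A) i \<subseteq> ?B (insert v A) i"
        using Suc.hyps(1)[of "insert v A"] Suc.prems v by blast
      have step: "?B (insert v A) i \<inter> ?C A i \<subseteq> ?B A i"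
        using none v Suc.prems unfolding killed by blast
      have "?C A i \<subseteq> ?C (insert v A) i"
        by (rule face_chains_mono) (rule induced_mono, blast)
      then show ?case using IH step by blast
    qed
    have "?BX i \<inter> ?C A i \<subseteq> ?B A i" for A i
      using sub[of "A \<inter> vertices X" i] by (simp add: induced_Int_vertices[OF X])
    then show "\<forall>A i. ?BX i \<inter> ?C A i \<subseteq> ?B A i" by blast
  qed
  then show ?thesis by (simp add: tight_def inj_on_homology_iff[OF X])
qed

text \<open>A class of degree \<open>i\<close> is killed by chains of degree \<open>i + 1\<close>, and these vanish.\<close>

lemma killed_dim_top:
  fixes X :: "'v set set" and F :: "'f::field itself"
  assumes X: "simplicial_complex X" and "complex_dim X \<le> int i"
  shows "killed_dim F X A v i = 0"
proof -
  have "card \<alpha> < Suc (Suc i)" if "\<alpha> \<in> induced X (insert v A)" for \<alpha>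
  proof -
    have "finite X" "\<alpha> \<in> X" using X that by (auto simp: simplicial_complex_def induced_def)
    then have "int (card \<alpha>) - 1 \<le> complex_dim X" unfolding complex_dim_def by (intro Max_ge) auto
    then show ?thesis using assms(2) by linarith
  qed
  then have "face_chains (induced X (insert v A)) (Suc (Suc i)) = {\<lambda>_ :: 'v list. 0 :: 'f}"
    by (rule face_chains_zero)
  then have "aug_boundaries (induced X (insert v A)) (Suc i) = {\<lambda>_ :: 'v list. 0 :: 'f}"
    by (simp add: aug_boundaries_def aug_boundary_def)
  then show ?thesis
    unfolding killed_dim_eq_0_iff[OF X]
    using fun_subspace_zero[OF fun_subspace_aug_boundaries[of "induced X A" "Suc i"]] by auto
qed

text \<open>The \<open>j\<close>-th equation says that nothing is killed in the degrees \<open>j\<close> and \<open>j - 1\<close>, so the equations up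
  to \<open>d\<close> cover all degrees in which anything can be killed.\<close>

theorem corollary1p8:
  fixes X :: "'v set set" and d :: int
  assumes "simplicial_complex X"
    and "complex_dim X = d"
  shows "tight TYPE('f::field) X \<longleftrightarrow>
    connected_complex X \<and>
    (\<forall>j::nat. int j \<le> d \<longrightarrow> mu TYPE('f) X j = real (betti TYPE('f) X j))"
proof -
  let ?k = "killed_dim TYPE('f) X"
  have "(\<forall>j. int j \<le> d \<longrightarrow> mu TYPE('f) X j = real (betti TYPE('f) X j)) \<longleftrightarrow>
    (\<forall>v\<in>vertices X. \<forall>A\<subseteq>vertices X - {v}. \<forall>i. ?k A v i = 0)"
  proof
    assume mu: "\<forall>j. int j \<le> d \<longrightarrow> mu TYPE('f) X j = real (betti TYPE('f) X j)"
    have "?k A v i = 0" if "v \<in> vertices X" "A \<subseteq> vertices X - {v}" for v A i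
    proof (cases "int i \<le> d")
      case True
      then show ?thesis using mu that unfolding mu_eq_betti_iff[OF assms(1)] by blast
    next
      case False
      then show ?thesis using assms(2) by (intro killed_dim_top[OF assms(1)]) simp
    qed
    then show "\<forall>v\<in>vertices X. \<forall>A\<subseteq>vertices X - {v}. \<forall>i. ?k A v i = 0" by blast
  next
    assume "\<forall>v\<in>vertices X. \<forall>A\<subseteq>vertices X - {v}. \<forall>i. ?k A v i = 0"
    then show "\<forall>j. int j \<le> d \<longrightarrow> mu TYPE('f) X j = real (betti TYPE('f) X j)"
      unfolding mu_eq_betti_iff[OF assms(1)] by blast
  qed
  then show ?thesis unfolding tight_iff_nothing_killed[OF assms(1)] by blast
qed

end
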